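(* There exist real random variables $X$ and $Y$ on a common probability space with joint characteristic function $$\mathbb{E}\left(e^{itX+isY}\right)=\frac{e^{-2|t|-t^2+it^2s}}{1+s^2},\qquad t,s\in\mathbb{R};$$ that is, the right-hand side is the characteristic function of a probability distribution on $\mathbb{R}^2$. If $(X',Y')$ is an independent copy of such a pair $(X,Y)$ (independent of $(X,Y)$ and with the same joint distribution), then $X-X'$ and $Y-Y'$ are independent, but $X$ and $Y$ are not independent. Consequently, independence of the symmetrized variables $X-X'$ and $Y-Y'$ does not imply independence of $X$ and $Y$. *)

theory Defs
  imports "HOL-Probability.Probability"
begin

definition char2 :: "(real \<times> real) measure \<Rightarrow> real \<Rightarrow> real \<Rightarrow> complex" where
  "char2 \<mu> t s = (CLINT z|\<mu>. iexp (t * fst z + s * snd z))"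

context prob_space
begin

definition joint_char :: "('a \<Rightarrow> real) \<Rightarrow> ('a \<Rightarrow> real) \<Rightarrow> real \<Rightarrow> real \<Rightarrow> complex" where
  "joint_char X Y t s = (CLINT \<omega>|M. iexp (t * X \<omega> + s * Y \<omega>))"

definition independent_copy ::
  "('a \<Rightarrow> real) \<Rightarrow> ('a \<Rightarrow> real) \<Rightarrow> ('a \<Rightarrow> real) \<Rightarrow> ('a \<Rightarrow> real) \<Rightarrow> bool" where
  "independent_copy X Y X' Y' \<longleftrightarrow>
     random_variable borel X' \<and> random_variable borel Y' \<and>
     indep_var borel (\<lambda>\<omega>. (X \<omega>, Y \<omega>)) borel (\<lambda>\<omega>. (X' \<omega>, Y' \<omega>)) \<and>
     distr M borel (\<lambda>\<omega>. (X' \<omega>, Y' \<omega>)) = distr M borel (\<lambda>\<omega>. (X \<omega>, Y \<omega>))"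

end

definition target_char :: "real \<Rightarrow> real \<Rightarrow> complex" where
  "target_char t s =
     exp (complex_of_real (- 2 * \<bar>t\<bar> - t\<^sup>2) + \<i> * complex_of_real (t\<^sup>2 * s))
       / complex_of_real (1 + s\<^sup>2)"

end

(* Inverting the transform in s turns target_char t s into exp (- |y|) / 2 * G_y(t), where
   G_y(t) = exp (- 2|t|) for t^2 <= max y 0 and G_y(t) = exp (2 max y 0 - 2|t| - 2t^2) otherwise.  So it
   suffices that the cosine transform T of G_y is nonnegative and integrable; Fourier inversion then
   gives a density on the plane.  With a = sqrt (max y 0), integration by parts yields
     (4 + x^2) T(x) = 2 + (remainder),
   where the remainder consists of a boundary term from the kink of G_y at a and an integral over (a, oo);
   it is at most 2 in absolute value by a Mills ratio estimate, so that 0 <= (4 + x^2) T(x) <= 4.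

   The characteristic function of (X - X', Y - Y') is |target_char|^2, in which the phase exp (i t^2 s)
   that couples t and s cancels; it therefore factorizes, and so the two differences are independent. *)

theory Submission
  imports Defs
begin

subsection \<open>Fourier inversion\<close>

text \<open>For fixed t, exp (i t^2 s) / (1 + s^2) is the transform in s of a Laplace density
  centred at t^2; this is the source of the kernel exp (- |y - t^2|). As long as t^2 <= y, its
  growth cancels the Gaussian factor exp (- t^2) exactly, so that only exp (- 2|t|) remains; beyond
  a the two decays add up. The obstacle is the kink at a > 0: the slope drops there by 4a exp (-
  2a), so the kernel is not convex on the half-line and Polya's criterion does not apply. Positivity
  has to come from the kink at 0. The factor 4 + x^2 corresponds to the operator 4 - d^2/dt^2,
  chosen because it annihilates exp (- 2t): the interval [0, a] then contributes boundary terms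
  only, and the main term 2 is minus the one-sided slope at 0. The remainder estimate has to hold
  for every a >= 0, and it has no slack at a = 0, where the bound obtained is exactly 2. This is why
  the signed weight and the tail integral are estimated so carefully.\<close>

lemma gauss_eq_std_normal_density: "exp (- z\<^sup>2 / 2) = sqrt (2 * pi) * std_normal_density z"
  by (simp add: std_normal_density_def)

lemma integrable_gauss: "integrable lborel (\<lambda>z :: real. exp (- z\<^sup>2 / 2))"
  unfolding gauss_eq_std_normal_density by simp

lemma fourier_gauss:
  "(CLINT z|lborel. iexp (v * z) * of_real (exp (- z\<^sup>2 / 2))) = of_real (sqrt (2 * pi) * exp (- v\<^sup>2 / 2))"
proof -
  have "(CLINT z|lborel. iexp (v * z) * of_real (exp (- z\<^sup>2 / 2)))
      = (CLINT z|lborel. of_real (sqrt (2 * pi)) * (std_normal_density z *\<^sub>R iexp (v * z)))"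
    unfolding gauss_eq_std_normal_density
    by (intro Bochner_Integration.integral_cong) (simp_all add: scaleR_conv_of_real algebra_simps)
  also have "\<dots> = of_real (sqrt (2 * pi)) * char std_normal_distribution v"
    by (subst integral_mult_right_zero) (simp add: char_def integral_density)
  finally show ?thesis by (simp add: char_std_normal_distribution)
qed

text \<open>After damping by a Gaussian of width r, exchanging the integrals turns the left-hand
  side into an average of \<open>g\<close> against a Gaussian of width 1/r around \<open>t\<close>.
  As r grows, integrability of \<open>h\<close> removes the damping on one side, while boundedness
  of \<open>g\<close> and continuity at \<open>t\<close> make the average concentrate at
  \<open>g t\<close> on the other.\<close>

lemma fourier_inversion:
  fixes g :: "real \<Rightarrow> complex"
  defines "h \<equiv> \<lambda>x. CLINT u|lborel. iexp (- (u * x)) * g u"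
  assumes g: "integrable lborel g" and bound: "\<And>u. cmod (g u) \<le> B" and cont: "isCont g t"
    and h: "integrable lborel h"
  shows "(CLINT x|lborel. iexp (t * x) * h x) = 2 * pi * g t"
proof -
  have [measurable]: "g \<in> borel_measurable borel" "h \<in> borel_measurable borel"
    using borel_measurable_integrable[OF g] borel_measurable_integrable[OF h] by simp_all
  define I where "I r = (CLINT x|lborel. iexp (t * x) * h x * of_real (exp (- (x / r)\<^sup>2 / 2)))" for r :: real
  \<comment> \<open>Gaussian regularization makes Fubini applicable.\<close>
  have eq: "I r = (CLINT z|lborel. of_real (sqrt (2 * pi)) * (g (t + z / r) * of_real (exp (- z\<^sup>2 / 2))))"
    if r: "r > 0" for r
  proof -
    have G: "integrable lborel (\<lambda>x. exp (- (x / r)\<^sup>2 / 2))"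
      using lborel_integrable_real_affine[OF integrable_gauss, of "1/r" 0] r by simp
    have int: "integrable (lborel \<Otimes>\<^sub>M lborel)
      (\<lambda>(x, u). iexp (t * x) * (iexp (- (u * x)) * g u) * of_real (exp (- (x / r)\<^sup>2 / 2)))"
    proof (rule lborel_pair.Fubini_integrable)
      have "(\<lambda>x. LINT u|lborel. norm (iexp (t * x) * (iexp (- (u * x)) * g u) * of_real (exp (- (x / r)\<^sup>2 / 2))))
         = (\<lambda>x. (LINT u|lborel. norm (g u)) * exp (- (x / r)\<^sup>2 / 2))"
        by (simp add: norm_mult del: of_real_mult of_real_minus)
      then show "integrable lborel (\<lambda>x. LINT u|lborel. norm (case (x, u) of
          (x, u) \<Rightarrow> iexp (t * x) * (iexp (- (u * x)) * g u) * of_real (exp (- (x / r)\<^sup>2 / 2))))"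
        using G by simp
      show "AE x in lborel. integrable lborel (\<lambda>u. case (x, u) of
          (x, u) \<Rightarrow> iexp (t * x) * (iexp (- (u * x)) * g u) * of_real (exp (- (x / r)\<^sup>2 / 2)))"
      proof (rule AE_I2)
        fix x
        have "integrable lborel (\<lambda>u. iexp (- (u * x)) * g u)"
          by (rule Bochner_Integration.integrable_bound[OF g]) (auto simp: norm_mult simp del: of_real_mult of_real_minus)
        then show "integrable lborel (\<lambda>u. case (x, u) of
          (x, u) \<Rightarrow> iexp (t * x) * (iexp (- (u * x)) * g u) * of_real (exp (- (x / r)\<^sup>2 / 2)))"
          by simp
      qed
    qed measurable
    have inner: "(CLINT x|lborel. iexp (v * x) * of_real (exp (- (x / r)\<^sup>2 / 2)))
        = of_real (r * sqrt (2 * pi) * exp (- (r * v)\<^sup>2 / 2))" for v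
    proof -
      have "(CLINT x|lborel. iexp (v * x) * of_real (exp (- (x / r)\<^sup>2 / 2)))
         = r *\<^sub>R (CLINT z|lborel. iexp ((r * v) * z) * of_real (exp (- z\<^sup>2 / 2)))"
        using r by (subst lborel_integral_real_affine[of r _ 0]) (simp_all add: mult_ac)
      then show ?thesis unfolding fourier_gauss by (simp add: scaleR_conv_of_real)
    qed
    have "I r = (CLINT x|lborel. CLINT u|lborel.
        iexp (t * x) * (iexp (- (u * x)) * g u) * of_real (exp (- (x / r)\<^sup>2 / 2)))"
      unfolding I_def h_def by simp
    also have "\<dots> = (CLINT u|lborel. CLINT x|lborel.
        iexp (t * x) * (iexp (- (u * x)) * g u) * of_real (exp (- (x / r)\<^sup>2 / 2)))"
      using lborel_pair.Fubini_integral[OF int] by simp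
    also have "\<dots> = (CLINT u|lborel. g u * (CLINT x|lborel. iexp ((t - u) * x) * of_real (exp (- (x / r)\<^sup>2 / 2))))"
    proof -
      have "iexp (t * x) * (iexp (- (u * x)) * g u) * of_real (exp (- (x / r)\<^sup>2 / 2))
        = g u * (iexp ((t - u) * x) * of_real (exp (- (x / r)\<^sup>2 / 2)))" for x u
      proof -
        have "iexp ((t - u) * x) = iexp (t * x) * iexp (- (u * x))"
          by (simp add: exp_add[symmetric] algebra_simps)
        then show ?thesis by (simp only: mult_ac)
      qed
      then show ?thesis by (simp only: integral_mult_right_zero)
    qed
    also have "\<dots> = (CLINT u|lborel. g u * of_real (r * sqrt (2 * pi) * exp (- (r * (t - u))\<^sup>2 / 2)))"
      unfolding inner ..
    \<comment> \<open>The substitution u = t + z / r moves the dependence on r from the Gaussian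
      into the argument of \<open>g\<close>, and its Jacobian 1/r cancels the factor r of the
      Gaussian transform.\<close>
    also have "\<dots> = (1 / r) *\<^sub>R (CLINT z|lborel. g (t + z / r) * of_real (r * sqrt (2 * pi) * exp (- z\<^sup>2 / 2)))"
      using r by (subst lborel_integral_real_affine[of "1 / r" _ t]) simp_all
    also have "\<dots> = (CLINT z|lborel. (1 / r) *\<^sub>R (g (t + z / r) * of_real (r * sqrt (2 * pi) * exp (- z\<^sup>2 / 2))))"
      by (rule integral_scaleR_right[symmetric])
    also have "\<dots> = (CLINT z|lborel. of_real (sqrt (2 * pi)) * (g (t + z / r) * of_real (exp (- z\<^sup>2 / 2))))"
      using r by (intro Bochner_Integration.integral_cong) (simp_all add: scaleR_conv_of_real)
    finally show ?thesis .
  qed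
  have lim1: "(\<lambda>k. I (real (Suc k))) \<longlonglongrightarrow> (CLINT x|lborel. iexp (t * x) * h x)"
    unfolding I_def
  proof (rule integral_dominated_convergence[where w="\<lambda>x. norm (h x)"])
    show "AE x in lborel. (\<lambda>k. iexp (t * x) * h x * of_real (exp (- (x / real (Suc k))\<^sup>2 / 2)))
        \<longlonglongrightarrow> iexp (t * x) * h x"
    proof (rule AE_I2)
      fix x
      have "(\<lambda>k. x / real (Suc k)) \<longlonglongrightarrow> 0"
        by (rule LIMSEQ_Suc[OF lim_const_over_n])
      then have "(\<lambda>k. complex_of_real (exp (- (x / real (Suc k))\<^sup>2 / 2))) \<longlonglongrightarrow> of_real (exp (- 0\<^sup>2 / 2))"
        by (intro tendsto_intros) auto
      from tendsto_mult_left[OF this, of "iexp (t * x) * h x"]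
      show "(\<lambda>k. iexp (t * x) * h x * of_real (exp (- (x / real (Suc k))\<^sup>2 / 2)))
        \<longlonglongrightarrow> iexp (t * x) * h x" by simp
    qed
    show "AE x in lborel. norm (iexp (t * x) * h x * of_real (exp (- (x / real (Suc k))\<^sup>2 / 2))) \<le> norm (h x)" for k
      by (auto simp: norm_mult mult_left_le simp del: of_real_mult)
  qed (use h in simp_all)
  have lim2: "(\<lambda>k. CLINT z|lborel. of_real (sqrt (2 * pi)) * (g (t + z / real (Suc k)) * of_real (exp (- z\<^sup>2 / 2))))
     \<longlonglongrightarrow> (CLINT z|lborel. of_real (sqrt (2 * pi)) * (g t * of_real (exp (- z\<^sup>2 / 2))))"
  proof (rule integral_dominated_convergence[where w="\<lambda>z. sqrt (2 * pi) * (B * exp (- z\<^sup>2 / 2))"])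
    show "AE z in lborel. (\<lambda>k. of_real (sqrt (2 * pi)) * (g (t + z / real (Suc k)) * of_real (exp (- z\<^sup>2 / 2))))
        \<longlonglongrightarrow> of_real (sqrt (2 * pi)) * (g t * of_real (exp (- z\<^sup>2 / 2)))"
    proof (rule AE_I2)
      fix z
      have "(\<lambda>k. z / real (Suc k)) \<longlonglongrightarrow> 0"
        by (rule LIMSEQ_Suc[OF lim_const_over_n])
      then have "(\<lambda>k. t + z / real (Suc k)) \<longlonglongrightarrow> t"
        using tendsto_add[OF tendsto_const, of _ 0 _ t] by simp
      then have "(\<lambda>k. g (t + z / real (Suc k))) \<longlonglongrightarrow> g t"
        by (rule isCont_tendsto_compose[OF cont])
      then show "(\<lambda>k. of_real (sqrt (2 * pi)) * (g (t + z / real (Suc k)) * of_real (exp (- z\<^sup>2 / 2))))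
        \<longlonglongrightarrow> of_real (sqrt (2 * pi)) * (g t * of_real (exp (- z\<^sup>2 / 2)))"
        by (intro tendsto_intros)
    qed
    show "integrable lborel (\<lambda>z. sqrt (2 * pi) * (B * exp (- z\<^sup>2 / 2)))"
      using integrable_gauss by simp
    show "AE z in lborel. norm (of_real (sqrt (2 * pi)) * (g (t + z / real (Suc k)) * of_real (exp (- z\<^sup>2 / 2))))
       \<le> sqrt (2 * pi) * (B * exp (- z\<^sup>2 / 2))" for k
      by (auto simp: norm_mult intro!: mult_mono bound)
  qed simp_all
  \<comment> \<open>The total Gaussian mass is read off from \<open>fourier_gauss\<close> at
    frequency 0; it supplies the second factor sqrt (2 pi).\<close>
  have "(CLINT z|lborel. of_real (sqrt (2 * pi)) * (g t * of_real (exp (- z\<^sup>2 / 2))))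
      = of_real (sqrt (2 * pi)) * (g t * (CLINT z|lborel. iexp (0 * z) * of_real (exp (- z\<^sup>2 / 2))))"
    by simp
  also have "\<dots> = 2 * pi * g t"
    unfolding fourier_gauss by (simp add: mult_ac flip: of_real_mult)
  finally have "(\<lambda>k. I (real (Suc k))) \<longlonglongrightarrow> 2 * pi * g t"
    using lim2 by (simp only: eq[OF of_nat_0_less_iff[THEN iffD2, OF zero_less_Suc]])
  then show ?thesis by (rule LIMSEQ_unique[OF lim1])
qed

subsection \<open>The tail of the kernel\<close>

lemma greaterThan_eq_einterval: "{a<..} = einterval (ereal a) \<infinity>"
  by (auto simp: einterval_def)

text \<open>This version serves oscillating integrands, whose integrability has to be known
  beforehand. The derivative is required at \<open>a\<close> itself, which makes \<open>F\<close>
  continuous there and lets the boundary value be \<open>F a\<close>.\<close>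

lemma set_integral_FTC_greaterThan:
  fixes f F :: "real \<Rightarrow> 'a :: euclidean_space"
  assumes F: "\<And>x. a \<le> x \<Longrightarrow> (F has_vector_derivative f x) (at x)"
    and cont: "\<And>x. a < x \<Longrightarrow> isCont f x"
    and int: "set_integrable lborel {a<..} f"
    and lim: "(F \<longlongrightarrow> T) at_top"
  shows "(LINT x:{a<..}|lborel. f x) = T - F a"
proof -
  have "isCont F a" using F[of a] by (auto intro: has_vector_derivative_continuous)
  then have "(F \<longlongrightarrow> F a) (at_right a)"
    by (auto simp: isCont_def intro: filterlim_mono[OF _ order_refl at_le])
  then have "(LBINT x=ereal a..\<infinity>. f x) = T - F a"
  proof (intro interval_integral_FTC_integrable)
    show "set_integrable lborel (einterval (ereal a) \<infinity>) f"
      using int by (simp only: greaterThan_eq_einterval)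
  qed (use F cont lim in \<open>simp_all add: ereal_tendsto_simps\<close>)
  then show ?thesis
    unfolding interval_lebesgue_integral_def greaterThan_eq_einterval by simp
qed

text \<open>For a nonnegative integrand, a finite limit of the antiderivative already forces
  integrability; the lemma is used as an integrability criterion as much as for the value.\<close>

lemma set_integral_FTC_greaterThan_nonneg:
  fixes f F :: "real \<Rightarrow> real"
  assumes F: "\<And>x. a \<le> x \<Longrightarrow> (F has_real_derivative f x) (at x)"
    and cont: "\<And>x. a < x \<Longrightarrow> isCont f x"
    and nonneg: "\<And>x. a < x \<Longrightarrow> 0 \<le> f x"
    and lim: "(F \<longlongrightarrow> T) at_top"
  shows "set_integrable lborel {a<..} f" "(LINT x:{a<..}|lborel. f x) = T - F a"
proof -
  have "isCont F a" using F[of a] by (auto intro: DERIV_isCont)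
  then have *: "(F \<longlongrightarrow> F a) (at_right a)"
    by (auto simp: isCont_def intro: filterlim_mono[OF _ order_refl at_le])
  have "set_integrable lborel (einterval (ereal a) \<infinity>) f" "(LBINT x=ereal a..\<infinity>. f x) = T - F a"
    using F cont nonneg lim *
    by (intro interval_integral_FTC_nonneg[where F = F]; simp add: ereal_tendsto_simps)+
  then show "set_integrable lborel {a<..} f" "(LINT x:{a<..}|lborel. f x) = T - F a"
    unfolding interval_lebesgue_integral_def greaterThan_eq_einterval by simp_all
qed

text \<open>The outer branch of the kernel, with \<open>a\<close> standing for sqrt (max y 0). The
  constant 2a^2 makes it agree with exp (- 2t) at t = a. Up to a constant factor it is the Gaussian
  exp (- 2 (t + 1/2)^2).\<close>

definition tail :: "real \<Rightarrow> real \<Rightarrow> real" where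
  "tail a t = exp (2 * a\<^sup>2 - 2 * t - 2 * t\<^sup>2)"

lemma tail_pos [simp]: "0 < tail a t" by (simp add: tail_def)

lemma tail_nonneg [simp]: "0 \<le> tail a t" by (simp add: tail_def)

lemma tail_self [simp]: "tail a a = exp (- 2 * a)" by (simp add: tail_def)

lemma DERIV_tail: "(tail a has_real_derivative - (2 + 4 * t) * tail a t) (at t)"
  unfolding tail_def[abs_def] by (auto intro!: derivative_eq_intros simp: algebra_simps)

lemma isCont_tail [continuous_intros]: "isCont (tail a) t"
  using DERIV_tail by (rule DERIV_isCont)

lemma tail_le: "0 \<le> a \<Longrightarrow> a \<le> t \<Longrightarrow> tail a t \<le> exp (- 2 * a)"
  using power_mono[of a t 2] by (simp add: tail_def del: power_mono_iff)

lemma tail_tendsto_0: "(tail a \<longlongrightarrow> 0) at_top"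
  unfolding tail_def[abs_def] by real_asymp

lemma linear_tail_tendsto_0: "((\<lambda>t. (2 + 4 * t) * tail a t) \<longlongrightarrow> 0) at_top"
  unfolding tail_def[abs_def] by real_asymp

lemma tail_borel [measurable]: "tail a \<in> borel_measurable borel"
  unfolding tail_def[abs_def] by measurable

lemma integrable_tail:
  assumes "0 \<le> a" shows "set_integrable lborel {a<..} (tail a)"
proof -
  \<comment> \<open>This integrand is minus the derivative of \<open>tail a\<close>, hence
    integrable, and it dominates \<open>tail a\<close> because 2 + 4t >= 1 for t > a >= 0.\<close>
  have "set_integrable lborel {a<..} (\<lambda>t. (2 + 4 * t) * tail a t)"
  proof (rule set_integral_FTC_greaterThan_nonneg)
    show "((\<lambda>t. - tail a t) has_real_derivative (2 + 4 * t) * tail a t) (at t)" for t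
      using DERIV_minus[OF DERIV_tail[of a t]] by (simp add: algebra_simps)
    show "((\<lambda>t. - tail a t) \<longlongrightarrow> 0) at_top"
      using tendsto_minus[OF tail_tendsto_0] by simp
  qed (use assms in \<open>auto intro!: continuous_intros\<close>)
  then show ?thesis
    unfolding set_integrable_def
  proof (rule Bochner_Integration.integrable_bound)
    have "tail a t \<le> \<bar>2 + 4 * t\<bar> * tail a t" if "a < t" for t
      using that assms mult_right_mono[of 1 "\<bar>2 + 4 * t\<bar>" "tail a t"] by simp
    then show "AE t in lborel. norm (indicat_real {a<..} t *\<^sub>R tail a t)
        \<le> norm (indicat_real {a<..} t *\<^sub>R ((2 + 4 * t) * tail a t))"
      by (auto simp: abs_mult split: split_indicator)
  qed measurable
qed

text \<open>The integrand is the second derivative of \<open>tail a\<close>, since (2 + 4t)^2 - 4 =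
  16t^2 + 16t. It is nonnegative for t >= 0, and its integral is minus the first derivative at
  \<open>a\<close>.\<close>

lemma tail_second_derivative:
  assumes "0 \<le> a"
  shows "set_integrable lborel {a<..} (\<lambda>t. (16 * t\<^sup>2 + 16 * t) * tail a t)"
    and "(LINT t:{a<..}|lborel. (16 * t\<^sup>2 + 16 * t) * tail a t) = (2 + 4 * a) * exp (- 2 * a)"
proof -
  have d: "((\<lambda>t. - ((2 + 4 * t) * tail a t)) has_real_derivative (16 * t\<^sup>2 + 16 * t) * tail a t) (at t)" for t
    by (rule derivative_eq_intros DERIV_tail refl)+ (simp add: algebra_simps power2_eq_square)
  have l: "((\<lambda>t. - ((2 + 4 * t) * tail a t)) \<longlongrightarrow> 0) at_top"
    using tendsto_minus[OF linear_tail_tendsto_0] by simp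
  note F = set_integral_FTC_greaterThan_nonneg[OF d _ _ l, of a]
  show "set_integrable lborel {a<..} (\<lambda>t. (16 * t\<^sup>2 + 16 * t) * tail a t)"
    by (rule F(1)) (use assms in \<open>auto intro!: continuous_intros\<close>)
  have "(LINT t:{a<..}|lborel. (16 * t\<^sup>2 + 16 * t) * tail a t) = 0 - (- ((2 + 4 * a) * tail a a))"
    by (rule F(2)) (use assms in \<open>auto intro!: continuous_intros\<close>)
  then show "(LINT t:{a<..}|lborel. (16 * t\<^sup>2 + 16 * t) * tail a t) = (2 + 4 * a) * exp (- 2 * a)"
    by simp
qed

text \<open>A Mills ratio bound: with q(t) = 1 + 2t + 2t^2, the left-hand side is the integral of (4 - 2 / q^2) times the tail.\<close>

lemma tail_integral_ge:
  assumes a: "0 \<le> a"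
  shows "(1 + 2 * a) / (1 + 2 * a + 2 * a\<^sup>2) * exp (- 2 * a) \<le> 4 * (LINT t:{a<..}|lborel. tail a t)"
proof -
  \<comment> \<open>In the variable x = 1 + 2t the tail is a multiple of exp (- x^2 / 2), and 2 q(t)
    = 1 + x^2. Thus (1 + 2t) / q(t) is twice x / (1 + x^2), the classical lower bound for the Mills
    ratio.\<close>
  define q where "q t = 1 + 2 * t + 2 * t\<^sup>2" for t :: real
  have q: "q t \<ge> 1" if "t \<ge> 0" for t using that by (simp add: q_def)
  have d: "((\<lambda>t. - ((1 + 2 * t) / q t * tail a t)) has_real_derivative (4 - 2 / (q t)\<^sup>2) * tail a t) (at t)"
    if "a \<le> t" for t
  proof -
    have nz: "q t \<noteq> 0" using q[of t] a that by linarith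
    have "(q has_real_derivative 2 + 4 * t) (at t)"
      unfolding q_def[abs_def] by (auto intro!: derivative_eq_intros)
    then have "((\<lambda>t. (1 + 2 * t) / q t) has_real_derivative
        (2 * q t - (1 + 2 * t) * (2 + 4 * t)) / (q t * q t)) (at t)"
      using nz by (auto intro!: derivative_eq_intros)
    moreover have N: "(1 + 2 * t) * (2 + 4 * t) = 4 * q t - 2"
      by (simp add: q_def algebra_simps power2_eq_square)
    ultimately have "((\<lambda>t. (1 + 2 * t) / q t) has_real_derivative 2 / (q t)\<^sup>2 - 2 / q t) (at t)"
      using nz by (simp add: diff_divide_distrib power2_eq_square)
    from DERIV_minus[OF DERIV_mult[OF this DERIV_tail]]
    have "((\<lambda>t. - ((1 + 2 * t) / q t * tail a t)) has_real_derivative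
        - ((2 / (q t)\<^sup>2 - 2 / q t) * tail a t + - (2 + 4 * t) * tail a t * ((1 + 2 * t) / q t))) (at t)" .
    also have "- ((2 / (q t)\<^sup>2 - 2 / q t) * tail a t + - (2 + 4 * t) * tail a t * ((1 + 2 * t) / q t))
        = ((1 + 2 * t) * (2 + 4 * t) / q t - (2 / (q t)\<^sup>2 - 2 / q t)) * tail a t"
    proof -
      have "- (d * T + - b * T * (n / r)) = (n * b / r - d) * T" for d T b n r :: real
        by (simp add: algebra_simps)
      then show ?thesis .
    qed
    also have "(1 + 2 * t) * (2 + 4 * t) / q t = 4 - 2 / q t"
      unfolding N using nz by (simp add: diff_divide_distrib)
    finally show ?thesis by simp
  qed
  have l: "((\<lambda>t. - ((1 + 2 * t) / q t * tail a t)) \<longlongrightarrow> 0) at_top"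
    unfolding q_def tail_def[abs_def] by real_asymp
  have c: "isCont (\<lambda>t. (4 - 2 / (q t)\<^sup>2) * tail a t) t" if "a < t" for t
  proof -
    have "q t \<noteq> 0" using q[of t] a that by simp
    then show ?thesis unfolding q_def by (intro continuous_intros) auto
  qed
  have n: "0 \<le> (4 - 2 / (q t)\<^sup>2) * tail a t" if "a < t" for t
  proof -
    have "1 \<le> (q t)\<^sup>2" using q[of t] a that by simp
    then have "2 / (q t)\<^sup>2 \<le> 2" by (simp add: divide_le_eq)
    then show ?thesis by simp
  qed
  note F = set_integral_FTC_greaterThan_nonneg[OF d c n l]
  have "(1 + 2 * a) / q a * exp (- 2 * a) = (LINT t:{a<..}|lborel. (4 - 2 / (q t)\<^sup>2) * tail a t)"
    by (simp add: F(2))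
  also have "\<dots> \<le> (LINT t:{a<..}|lborel. 4 * tail a t)"
    using F(1) integrable_tail[OF a] by (intro set_integral_mono) (auto intro!: mult_right_mono)
  also have "\<dots> = 4 * (LINT t:{a<..}|lborel. tail a t)" by simp
  finally show ?thesis by (simp add: q_def)
qed

text \<open>The numerical inequality on which nonnegativity of the transform rests. Of the 8a, one
  half comes from the integral of the second derivative of the tail and the other half from the kink
  at a; the fraction is the Mills ratio bound, and the square is the price for replacing a signed
  weight by its absolute value. Equality holds at a = 0.\<close>

lemma tail_bound_polynomial:
  fixes a :: real assumes "0 \<le> a"
  shows "(2 + 8 * a - (1 + 2 * a) / (1 + 2 * a + 2 * a\<^sup>2) + (max 0 (1 - 4 * a))\<^sup>2) * exp (- 2 * a) \<le> 2"
proof -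
  define u where "u = 2 * a"
  have u: "u \<ge> 0" using assms by (simp add: u_def)
  \<comment> \<open>For a > 1/4 the cubic term matters: the quadratic part alone would leave the
    inequality 1 + u^2 >= 9u/4, which fails at u = 1.\<close>
  have e: "exp u \<ge> 1 + u + u\<^sup>2 / 2 + u^3 / 6"
  proof -
    have "(\<Sum>n<4. u ^ n /\<^sub>R fact n) \<le> (\<Sum>n. u ^ n /\<^sub>R fact n)"
      using summable_exp_generic[of u] u by (intro sum_le_suminf) auto
    then show ?thesis
      by (simp add: exp_def eval_nat_numeral field_simps)
  qed
  have qp: "1 + 2 * a + 2 * a\<^sup>2 > 0" using assms by (simp add: add_pos_nonneg)
  have "2 + 8 * a - (1 + 2 * a) / (1 + 2 * a + 2 * a\<^sup>2) + (max 0 (1 - 4 * a))\<^sup>2 \<le> 2 * exp u"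
  proof (cases "a \<le> 1/4")
    \<comment> \<open>Here the terms 8a cancel between the linear part and the square. What remains
      is 18a^2 <= 4a + 4a^2, which follows from a^2 <= a/4.\<close>
    case True
    have *: "- ((1 + 2 * a) / (1 + 2 * a + 2 * a\<^sup>2)) \<le> -1 + 2 * a\<^sup>2"
    proof -
      have "(1 - 2 * a\<^sup>2) * (1 + 2 * a + 2 * a\<^sup>2) \<le> 1 + 2 * a"
      proof -
        have "(1 - 2 * a\<^sup>2) * (1 + 2 * a + 2 * a\<^sup>2) = 1 + 2 * a - (4 * a^3 + 4 * a^4)" by algebra
        moreover have "0 \<le> 4 * a^3 + 4 * a^4" using assms by (intro add_nonneg_nonneg) auto
        ultimately show ?thesis by linarith
      qed
      then have "1 - 2 * a\<^sup>2 \<le> (1 + 2 * a) / (1 + 2 * a + 2 * a\<^sup>2)"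
        using qp by (simp only: pos_le_divide_eq)
      then show ?thesis by linarith
    qed
    have "(max 0 (1 - 4 * a))\<^sup>2 = 1 - 8 * a + 16 * a\<^sup>2"
      using True by (simp add: max_def power2_eq_square algebra_simps)
    moreover have "a\<^sup>2 \<le> a * (1/4)"
      unfolding power2_eq_square using True assms by (intro mult_left_mono) auto
    moreover have "2 * exp u \<ge> 2 + 4 * a + 4 * a\<^sup>2"
    proof -
      have "2 * exp u \<ge> 2 + 2 * u + u\<^sup>2" using e zero_le_power[OF u, of 3] by linarith
      then show ?thesis by (simp add: u_def power2_eq_square)
    qed
    ultimately show ?thesis using * assms by linarith
  next
    case False
    have m: "(max 0 (1 - 4 * a))\<^sup>2 = 0" using False by simp
    have "u\<^sup>2 / (2 + 2 * u + u\<^sup>2) \<le> u / 4"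
    proof -
      have "0 \<le> u * (u - 1)\<^sup>2 + u" using u by (intro add_nonneg_nonneg mult_nonneg_nonneg) auto
      also have "\<dots> = u * (2 + 2 * u + u\<^sup>2) - u\<^sup>2 * 4" by algebra
      finally have "u\<^sup>2 * 4 \<le> u * (2 + 2 * u + u\<^sup>2)" by simp
      moreover have "2 + 2 * u + u\<^sup>2 > 0" using u by (simp add: add_pos_nonneg)
      ultimately show ?thesis by (simp add: divide_le_eq)
    qed
    moreover have "(1 + 2 * a) / (1 + 2 * a + 2 * a\<^sup>2) = 1 - u\<^sup>2 / (2 + 2 * u + u\<^sup>2)"
    proof -
      have "2 + 2 * u + u\<^sup>2 = 2 * (1 + 2 * a + 2 * a\<^sup>2)" by (simp add: u_def power2_eq_square)
      moreover have "u\<^sup>2 = 2 * (2 * a\<^sup>2)" by (simp add: u_def power2_eq_square)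
      ultimately have "u\<^sup>2 / (2 + 2 * u + u\<^sup>2) = 2 * a\<^sup>2 / (1 + 2 * a + 2 * a\<^sup>2)"
        by (simp only: mult_divide_mult_cancel_left_if) simp
      then show ?thesis using qp by (simp add: field_simps)
    qed
    \<comment> \<open>The goal has been reduced to 9u/4 <= 1 + u^2 + u^3/3. The cube and the square
      are replaced by tangent lines, at 3/4 and at 27/32, with the common slope 27/16 chosen so that
      27/16 + (27/16)/3 = 9/4; the constants then sum to slightly less than 1.\<close>
    moreover have "u^3 \<ge> 27/16 * u - 27/32"
    proof -
      have "0 \<le> (u - 3/4)\<^sup>2 * (u + 3/2)" using u by (intro mult_nonneg_nonneg) auto
      also have "\<dots> = u^3 - (27/16 * u - 27/32)" by algebra
      finally show ?thesis by simp
    qed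
    moreover have "u\<^sup>2 \<ge> 27/16 * u - 729/1024"
    proof -
      have "0 \<le> (u - 27/32)\<^sup>2" by (rule zero_le_power2)
      also have "\<dots> = u\<^sup>2 - (27/16 * u - 729/1024)" by algebra
      finally show ?thesis by simp
    qed
    moreover have "2 + 8 * a = 2 + 4 * u" by (simp add: u_def)
    ultimately show ?thesis using e m by linarith
  qed
  then have "(2 + 8 * a - (1 + 2 * a) / (1 + 2 * a + 2 * a\<^sup>2) + (max 0 (1 - 4 * a))\<^sup>2) * exp (- u) \<le> 2 * exp u * exp (- u)"
    by (intro mult_right_mono) auto
  also have "\<dots> = 2" by (simp add: exp_minus)
  finally show ?thesis by (simp add: u_def)
qed

subsection \<open>Fourier and cosine transforms\<close>

lemma has_bochner_integral_even_greaterThan: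
  fixes f :: "real \<Rightarrow> 'a :: {banach, second_countable_topology}"
  assumes "has_bochner_integral lborel (\<lambda>x. indicator {0<..} x *\<^sub>R f x) I" and even: "\<And>x. f (- x) = f x"
  shows "has_bochner_integral lborel f (2 *\<^sub>R I)"
proof (rule has_bochner_integral_even_function)
  show "has_bochner_integral lborel (\<lambda>x. indicator {0..} x *\<^sub>R f x) I"
    using assms(1)
    by (rule has_bochner_integral_discrete_difference[where X="{0}", THEN iffD1, rotated 4])
       (auto split: split_indicator)
qed (rule even)

lemma has_bochner_integral_even_set:
  fixes f :: "real \<Rightarrow> 'a :: {banach, second_countable_topology}"
  assumes "set_integrable lborel {0<..} f" and "\<And>x. f (- x) = f x"
  shows "has_bochner_integral lborel f (2 *\<^sub>R (LINT x:{0<..}|lborel. f x))"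
  using assms unfolding set_integrable_def set_lebesgue_integral_def
  by (intro has_bochner_integral_even_greaterThan) (auto simp: has_bochner_integral_iff)

lemma integrable_exp_abs:
  assumes "0 < c" shows "integrable lborel (\<lambda>u :: real. exp (- c * \<bar>u\<bar>))"
proof -
  have "set_integrable lborel {0<..} (\<lambda>u. exp (- c * u))"
  proof (rule set_integral_FTC_greaterThan_nonneg)
    show "((\<lambda>u. - exp (- c * u) / c) has_real_derivative exp (- c * u)) (at u)" for u
      using assms by (auto intro!: derivative_eq_intros)
    show "((\<lambda>u. - exp (- c * u) / c) \<longlongrightarrow> 0) at_top"
      using assms by real_asymp
  qed (auto intro!: continuous_intros)
  then have "set_integrable lborel {0<..} (\<lambda>u. exp (- c * \<bar>u\<bar>))"
    by (rule set_integrable_cong[THEN iffD1, rotated 3]) auto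
  from has_bochner_integral_even_set[OF this] show ?thesis
    by (simp add: has_bochner_integral_iff)
qed

lemma integrable_inverse_4_plus_square: "integrable lborel (\<lambda>x :: real. 1 / (4 + x\<^sup>2))"
proof -
  have "set_integrable lborel {0<..} (\<lambda>x :: real. 1 / (4 + x\<^sup>2))"
  proof (rule set_integral_FTC_greaterThan_nonneg)
    have eq: "inverse (1 + (x / 2)\<^sup>2) * (1 / 2) / 2 = 1 / (4 + x\<^sup>2)" for x :: real
    proof -
      have "1 + (x / 2)\<^sup>2 = (4 + x\<^sup>2) / 4" by (simp add: power_divide)
      then show ?thesis by (simp add: inverse_eq_divide)
    qed
    show "((\<lambda>x. arctan (x / 2) / 2) has_real_derivative 1 / (4 + x\<^sup>2)) (at x)" for x :: real
      unfolding eq[symmetric] by (rule derivative_eq_intros refl | simp)+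
    show "((\<lambda>x. arctan (x / 2) / 2) \<longlongrightarrow> pi / 4) at_top"
      by real_asymp
    show "isCont (\<lambda>x :: real. 1 / (4 + x\<^sup>2)) x" for x
    proof -
      have "4 + x\<^sup>2 \<noteq> 0" using zero_le_power2[of x] by linarith
      then show ?thesis by (intro continuous_intros) auto
    qed
  qed (simp add: add_nonneg_nonneg)
  from has_bochner_integral_even_set[OF this] show ?thesis
    by (simp add: has_bochner_integral_iff)
qed

lemma fourier_even:
  fixes k :: "real \<Rightarrow> real"
  assumes k: "integrable lborel k" and even: "\<And>u. k (- u) = k u"
  shows "(CLINT u|lborel. iexp (u * x) * of_real (k u)) = of_real (LINT u|lborel. cos (u * x) * k u)"
proof -
  have [measurable]: "k \<in> borel_measurable borel" using borel_measurable_integrable[OF k] by simp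
  have c: "integrable lborel (\<lambda>u. cos (u * x) * k u)"
    by (rule Bochner_Integration.integrable_bound[OF k]) (auto simp: abs_mult mult_left_le_one_le)
  have s: "integrable lborel (\<lambda>u. sin (u * x) * k u)"
    by (rule Bochner_Integration.integrable_bound[OF k]) (auto simp: abs_mult mult_left_le_one_le)
  \<comment> \<open>The reflection u -> -u shows that the sine integral equals its own
    negative.\<close>
  have "(LINT u|lborel. sin (u * x) * k u) = - (LINT u|lborel. sin (u * x) * k u)"
    by (subst lborel_integral_real_affine[where c="-1" and t=0]) (auto simp: even)
  then have s0: "(LINT u|lborel. sin (u * x) * k u) = 0" by simp
  have iexp: "iexp v = of_real (cos v) + \<i> * of_real (sin v)" for v
    by (metis cis_conv_exp complex_eq cis.sel mult.commute)
  have "(CLINT u|lborel. iexp (u * x) * of_real (k u))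
      = (CLINT u|lborel. of_real (cos (u * x) * k u) + \<i> * of_real (sin (u * x) * k u))"
    unfolding iexp by (intro Bochner_Integration.integral_cong) (auto simp: algebra_simps)
  also have "\<dots> = of_real (LINT u|lborel. cos (u * x) * k u) + \<i> * of_real (LINT u|lborel. sin (u * x) * k u)"
    using c s by (subst Bochner_Integration.integral_add) (auto simp del: of_real_mult intro!: integrable_of_real)
  finally show ?thesis by (simp add: s0)
qed

text \<open>This produces the factor 1 / (1 + s^2) of the target. It will be applied after a shift
  by t^2, which accounts for the phase.\<close>

lemma fourier_laplace:
  "(CLINT z|lborel. iexp (z * s) * of_real (exp (- \<bar>z\<bar>))) = of_real (2 / (1 + s\<^sup>2))"
proof -
  have E: "integrable lborel (\<lambda>z :: real. exp (- \<bar>z\<bar>))"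
    using integrable_exp_abs[of 1] by simp
  have ic: "integrable lborel (\<lambda>z :: real. cos (z * s) * exp (- \<bar>z\<bar>))"
    by (rule Bochner_Integration.integrable_bound[OF E]) (auto simp: abs_mult mult_left_le_one_le)
  have nz: "1 + s\<^sup>2 \<noteq> 0" using zero_le_power2[of s] by linarith
  have si: "set_integrable lborel {0<..} (\<lambda>z. cos (z * s) * exp (- \<bar>z\<bar>))"
    unfolding set_integrable_def using integrable_mult_indicator[OF _ ic, of "{0<..}"] by simp
  have cong: "(LINT z:{0<..}|lborel. cos (z * s) * exp (- \<bar>z\<bar>)) = (LINT z:{0<..}|lborel. cos (z * s) * exp (- z))"
    by (intro set_lebesgue_integral_cong) auto
  have si': "set_integrable lborel {0<..} (\<lambda>z. cos (z * s) * exp (- z))"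
    using si by (rule set_integrable_cong[THEN iffD1, rotated 3]) auto
  have "(LINT z:{0<..}|lborel. cos (z * s) * exp (- z))
      = 0 - exp (- 0) * (s * sin (0 * s) - cos (0 * s)) / (1 + s\<^sup>2)"
  proof (rule set_integral_FTC_greaterThan[OF _ _ si',
        where F = "\<lambda>z. exp (- z) * (s * sin (z * s) - cos (z * s)) / (1 + s\<^sup>2)"])
    show "((\<lambda>z. exp (- z) * (s * sin (z * s) - cos (z * s)) / (1 + s\<^sup>2)) has_vector_derivative
        cos (z * s) * exp (- z)) (at z)" for z
    proof -
      have "((\<lambda>z. exp (- z) * (s * sin (z * s) - cos (z * s))) has_real_derivative
        (1 + s\<^sup>2) * (cos (z * s) * exp (- z))) (at z)"
        by (rule derivative_eq_intros refl)+ (simp add: algebra_simps power2_eq_square)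
      from DERIV_cdivide[OF this, of "1 + s\<^sup>2"] show ?thesis
        using nz by (simp add: has_real_derivative_iff_has_vector_derivative)
    qed
    show "isCont (\<lambda>z. cos (z * s) * exp (- z)) z" for z by (intro continuous_intros)
    have "((\<lambda>z. exp (- z) * (s * sin (z * s) - cos (z * s))) \<longlongrightarrow> 0) at_top"
    proof (rule Lim_null_comparison)
      show "\<forall>\<^sub>F z in at_top. norm (exp (- z) * (s * sin (z * s) - cos (z * s))) \<le> exp (- z) * (\<bar>s\<bar> + 1)"
      proof (rule always_eventually, rule allI)
        fix z
        have "\<bar>s * sin (z * s) - cos (z * s)\<bar> \<le> \<bar>s * sin (z * s)\<bar> + \<bar>cos (z * s)\<bar>"
          by (rule abs_triangle_ineq4)
        also have "\<dots> \<le> \<bar>s\<bar> + 1"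
          by (intro add_mono) (auto simp: abs_mult mult_left_le)
        finally show "norm (exp (- z) * (s * sin (z * s) - cos (z * s))) \<le> exp (- z) * (\<bar>s\<bar> + 1)"
          by (simp add: abs_mult)
      qed
      show "((\<lambda>z :: real. exp (- z) * (\<bar>s\<bar> + 1)) \<longlongrightarrow> 0) at_top"
        by (rule tendsto_mult_left_zero) real_asymp
    qed
    then show "((\<lambda>z. exp (- z) * (s * sin (z * s) - cos (z * s)) / (1 + s\<^sup>2)) \<longlongrightarrow> 0) at_top"
      by (rule tendsto_divide_zero)
  qed
  then have "(LINT z|lborel. cos (z * s) * exp (- \<bar>z\<bar>)) = 2 / (1 + s\<^sup>2)"
    using has_bochner_integral_integral_eq[OF has_bochner_integral_even_set[OF si]] cong by simp
  then show ?thesis using fourier_even[OF E, of s] by simp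
qed

text \<open>Two integrations by parts on each branch move x^2 onto the kernel. The operator 4 -
  d^2/dt^2 kills exp (- 2t) and turns the tail into - (16t^2 + 16t - 4) times the tail. At a the
  terms with x sin (a x) cancel because the kernel is continuous there; the jump of its slope from
  -2 to - (2 + 4a), times exp (- 2a), leaves the cosine term.\<close>

lemma cos_transform:
  fixes a x :: real
  assumes a: "0 \<le> a"
  shows "(4 + x\<^sup>2) * ((LINT t:{0..a}|lborel. cos (t * x) * exp (- 2 * t))
            + (LINT t:{a<..}|lborel. cos (t * x) * tail a t))
     = 2 + 4 * a * cos (a * x) * exp (- 2 * a)
        - (LINT t:{a<..}|lborel. cos (t * x) * ((16 * t\<^sup>2 + 16 * t - 4) * tail a t))"
proof -
  have cosb: "set_integrable lborel {a<..} (\<lambda>t. cos (t * x) * f t)"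
    if "set_integrable lborel {a<..} f" "f \<in> borel_measurable borel" for f
    using that(1) unfolding set_integrable_def
    by (rule Bochner_Integration.integrable_bound)
       (use that(2) in \<open>auto simp: abs_mult mult_left_le_one_le split: split_indicator\<close>)
  have i1: "set_integrable lborel {a<..} (\<lambda>t. cos (t * x) * tail a t)"
    by (rule cosb[OF integrable_tail[OF a]]) simp
  have i2: "set_integrable lborel {a<..} (\<lambda>t. cos (t * x) * ((16 * t\<^sup>2 + 16 * t) * tail a t))"
    by (rule cosb[OF tail_second_derivative(1)[OF a]]) measurable
  have "(4 + x\<^sup>2) * (LINT t:{0..a}|lborel. cos (t * x) * exp (- 2 * t))
      = (LINT t:{0..a}|lborel. (4 + x\<^sup>2) * (cos (t * x) * exp (- 2 * t)))" by simp
  also have "\<dots> = exp (- 2 * a) * (x * sin (a * x) - 2 * cos (a * x))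
        - exp (- 2 * 0) * (x * sin (0 * x) - 2 * cos (0 * x))"
    unfolding set_lebesgue_integral_def
  proof (rule integral_FTC_atLeastAtMost[OF a])
    fix t
    have "((\<lambda>t. exp (- 2 * t) * (x * sin (t * x) - 2 * cos (t * x))) has_real_derivative
        (4 + x\<^sup>2) * (cos (t * x) * exp (- 2 * t))) (at t)"
      by (rule derivative_eq_intros refl)+ (simp add: algebra_simps power2_eq_square)
    then show "((\<lambda>t. exp (- 2 * t) * (x * sin (t * x) - 2 * cos (t * x))) has_vector_derivative
        (4 + x\<^sup>2) * (cos (t * x) * exp (- 2 * t))) (at t within {0..a})"
      by (simp add: has_real_derivative_iff_has_vector_derivative has_vector_derivative_at_within)
  qed (intro continuous_intros)
  finally have 1: "(4 + x\<^sup>2) * (LINT t:{0..a}|lborel. cos (t * x) * exp (- 2 * t))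
     = 2 + exp (- 2 * a) * (x * sin (a * x) - 2 * cos (a * x))" by simp
  have "x\<^sup>2 * (LINT t:{a<..}|lborel. cos (t * x) * tail a t)
       + (LINT t:{a<..}|lborel. cos (t * x) * ((16 * t\<^sup>2 + 16 * t) * tail a t))
     = (LINT t:{a<..}|lborel. x\<^sup>2 * (cos (t * x) * tail a t) + cos (t * x) * ((16 * t\<^sup>2 + 16 * t) * tail a t))"
    using i1 i2 by simp
  \<comment> \<open>The antiderivative is x sin (t x) T(t) + cos (t x) T'(t) with T the tail: the
    mixed terms cancel on differentiation, leaving x^2 cos (t x) T + cos (t x) T''.\<close>
  also have "\<dots> = 0 - (x * sin (a * x) * tail a a - cos (a * x) * ((2 + 4 * a) * tail a a))"
  proof (rule set_integral_FTC_greaterThan[where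
        F = "\<lambda>t. x * sin (t * x) * tail a t - cos (t * x) * ((2 + 4 * t) * tail a t)"])
    show "((\<lambda>t. x * sin (t * x) * tail a t - cos (t * x) * ((2 + 4 * t) * tail a t)) has_vector_derivative
       x\<^sup>2 * (cos (t * x) * tail a t) + cos (t * x) * ((16 * t\<^sup>2 + 16 * t) * tail a t)) (at t)" for t
      unfolding has_real_derivative_iff_has_vector_derivative[symmetric]
      by (rule derivative_eq_intros DERIV_tail refl)+ (simp add: algebra_simps power2_eq_square)
    have z: "((\<lambda>t. b t * f t) \<longlongrightarrow> 0) at_top"
      if "(f \<longlongrightarrow> 0) at_top" "\<And>t. \<bar>b t\<bar> \<le> B" for b f :: "real \<Rightarrow> real" and B
    proof (rule Lim_null_comparison)
      show "\<forall>\<^sub>F t in at_top. norm (b t * f t) \<le> B * \<bar>f t\<bar>"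
        using that(2) by (intro always_eventually allI) (simp add: abs_mult mult_right_mono)
      show "((\<lambda>t. B * \<bar>f t\<bar>) \<longlongrightarrow> 0) at_top"
        by (rule tendsto_mult_right_zero) (rule tendsto_rabs_zero[OF that(1)])
    qed
    have "((\<lambda>t. x * sin (t * x) * tail a t) \<longlongrightarrow> 0) at_top"
      by (rule z[OF tail_tendsto_0, of _ "\<bar>x\<bar>"]) (auto simp: abs_mult mult_left_le)
    moreover have "((\<lambda>t. cos (t * x) * ((2 + 4 * t) * tail a t)) \<longlongrightarrow> 0) at_top"
      by (rule z[OF linear_tail_tendsto_0, of _ 1]) auto
    ultimately have "((\<lambda>t. x * sin (t * x) * tail a t - cos (t * x) * ((2 + 4 * t) * tail a t)) \<longlongrightarrow> 0 - 0) at_top"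
      by (rule tendsto_diff)
    then show "((\<lambda>t. x * sin (t * x) * tail a t - cos (t * x) * ((2 + 4 * t) * tail a t)) \<longlongrightarrow> 0) at_top"
      by simp
    show "set_integrable lborel {a<..}
       (\<lambda>t. x\<^sup>2 * (cos (t * x) * tail a t) + cos (t * x) * ((16 * t\<^sup>2 + 16 * t) * tail a t))"
      using i1 i2 by simp
  qed (auto intro!: continuous_intros)
  finally have 2: "x\<^sup>2 * (LINT t:{a<..}|lborel. cos (t * x) * tail a t)
       + (LINT t:{a<..}|lborel. cos (t * x) * ((16 * t\<^sup>2 + 16 * t) * tail a t))
     = - exp (- 2 * a) * (x * sin (a * x) - (2 + 4 * a) * cos (a * x))"
    by (simp add: algebra_simps)
  have "(LINT t:{a<..}|lborel. cos (t * x) * ((16 * t\<^sup>2 + 16 * t - 4) * tail a t))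
     = (LINT t:{a<..}|lborel. cos (t * x) * ((16 * t\<^sup>2 + 16 * t) * tail a t) - 4 * (cos (t * x) * tail a t))"
    by (intro set_lebesgue_integral_cong) (auto simp: algebra_simps)
  also have "\<dots> = (LINT t:{a<..}|lborel. cos (t * x) * ((16 * t\<^sup>2 + 16 * t) * tail a t))
       - 4 * (LINT t:{a<..}|lborel. cos (t * x) * tail a t)"
    using i1 i2 by simp
  finally show ?thesis using 1 2 by (simp add: algebra_simps)
qed

text \<open>The weight 16t^2 + 16t - 4 is negative only for small t: there, its absolute value exceeds it by
  at most the correction r, which vanishes beyond 1/4. The remaining signed integral is explicit up to
  the integral of the tail, which is bounded below by the Mills ratio estimate.\<close>

lemma abs_cos_tail_integral_le:
  assumes a: "0 \<le> a"
  shows "\<bar>LINT t:{a<..}|lborel. cos (t * x) * ((16 * t\<^sup>2 + 16 * t - 4) * tail a t)\<bar>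
     \<le> 2 - 4 * a * exp (- 2 * a)"
proof -
  define w where "w t = 16 * t\<^sup>2 + 16 * t" for t :: real
  \<comment> \<open>Where w < 4, the excess of |w - 4| over w - 4 is 2 (4 - w) = 8 - 32t - 32t^2.
    Dropping the quadratic term and bounding the tail by its value at a leaves an affine function
    with zero at 1/4, whose integral over (a, 1/4] is the square (1 - 4a)^2 times exp (-
    2a).\<close>
  define r where "r t = indicator {0..1/4} t * ((8 - 32 * t) * exp (- 2 * a))" for t :: real
  have wi: "set_integrable lborel {a<..} (\<lambda>t. w t * tail a t - 4 * tail a t)"
    using tail_second_derivative(1)[OF a] integrable_tail[OF a] by (simp add: w_def)
  have wI: "(LINT t:{a<..}|lborel. w t * tail a t - 4 * tail a t)
     = (2 + 4 * a) * exp (- 2 * a) - 4 * (LINT t:{a<..}|lborel. tail a t)"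
    using tail_second_derivative[OF a] integrable_tail[OF a] by (simp add: w_def)
  have rm: "set_integrable lborel {a<..} r" 
    and rI: "(LINT t:{a<..}|lborel. r t) = (max 0 (1 - 4 * a))\<^sup>2 * exp (- 2 * a)"
  proof -
    have eq: "indicator {a<..} t *\<^sub>R r t = indicator {a<..1/4} t *\<^sub>R ((8 - 32 * t) * exp (- 2 * a))" for t
      using a by (auto simp: r_def split: split_indicator)
    have i: "set_integrable lborel {a<..1/4} (\<lambda>t. (8 - 32 * t) * exp (- 2 * a))"
      by (rule set_integrable_subset[OF borel_integrable_atLeastAtMost'[of a "1/4"]])
         (auto intro!: continuous_intros)
    show "set_integrable lborel {a<..} r"
      using i unfolding set_integrable_def eq .
    show "(LINT t:{a<..}|lborel. r t) = (max 0 (1 - 4 * a))\<^sup>2 * exp (- 2 * a)"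
    proof (cases "a \<le> 1/4")
      case True
      have "(LINT t:{a<..}|lborel. r t) = (LINT t:{a<..1/4}|lborel. (8 - 32 * t) * exp (- 2 * a))"
        unfolding set_lebesgue_integral_def eq ..
      also have "\<dots> = (LINT t:{a..1/4}|lborel. (8 - 32 * t) * exp (- 2 * a))"
        unfolding set_lebesgue_integral_def
        by (rule integral_discrete_difference[where X="{a}"]) (auto split: split_indicator)
      also have "\<dots> = (8 * (1/4) - 16 * (1/4)\<^sup>2) * exp (- 2 * a) - (8 * a - 16 * a\<^sup>2) * exp (- 2 * a)"
        unfolding set_lebesgue_integral_def
      proof (rule integral_FTC_atLeastAtMost[OF True])
        fix t
        have "((\<lambda>t. (8 * t - 16 * t\<^sup>2) * exp (- 2 * a)) has_real_derivative (8 - 32 * t) * exp (- 2 * a)) (at t)"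
          by (auto intro!: derivative_eq_intros)
        then show "((\<lambda>t. (8 * t - 16 * t\<^sup>2) * exp (- 2 * a)) has_vector_derivative
            (8 - 32 * t) * exp (- 2 * a)) (at t within {a..1/4})"
          by (simp add: has_real_derivative_iff_has_vector_derivative has_vector_derivative_at_within)
      qed (intro continuous_intros)
      also have "\<dots> = (1 - 4 * a)\<^sup>2 * exp (- 2 * a)"
        by (simp add: power2_eq_square algebra_simps)
      finally show ?thesis using True by (simp add: max_def)
    next
      case False
      then have "(LINT t:{a<..}|lborel. r t) = 0"
        unfolding set_lebesgue_integral_def eq by simp
      then show ?thesis using False by simp
    qed
  qed
  have pw: "\<bar>cos (t * x) * ((16 * t\<^sup>2 + 16 * t - 4) * tail a t)\<bar> \<le> (w t * tail a t - 4 * tail a t) + r t"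
    if t: "a < t" for t
  proof -
    have "\<bar>cos (t * x) * ((16 * t\<^sup>2 + 16 * t - 4) * tail a t)\<bar> \<le> \<bar>w t - 4\<bar> * tail a t"
      by (simp add: abs_mult w_def mult_left_le_one_le)
    also have "\<dots> \<le> (w t * tail a t - 4 * tail a t) + r t"
    proof (cases "4 \<le> w t")
      case True
      have "0 \<le> r t" by (auto simp: r_def split: split_indicator)
      then show ?thesis using True by (simp add: left_diff_distrib)
    next
      case False
      have t0: "0 \<le> t" using t a by simp
      have "t \<le> 1/4" using False zero_le_power2[of t] unfolding w_def by linarith
      then have rt: "r t = (8 - 32 * t) * exp (- 2 * a)" using t0 by (simp add: r_def)
      have "2 * (4 - w t) * tail a t \<le> 2 * (4 - w t) * exp (- 2 * a)"
        using False t tail_le[OF a, of t] by (intro mult_left_mono) auto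
      also have "\<dots> \<le> (8 - 32 * t) * exp (- 2 * a)"
      proof (rule mult_right_mono)
        have "2 * (4 - w t) = 8 - 32 * t - 32 * t\<^sup>2" by (simp add: w_def)
        then show "2 * (4 - w t) \<le> 8 - 32 * t" by simp
      qed simp
      finally show ?thesis using False by (simp add: rt algebra_simps)
    qed
    finally show ?thesis .
  qed
  have "\<bar>LINT t:{a<..}|lborel. cos (t * x) * ((16 * t\<^sup>2 + 16 * t - 4) * tail a t)\<bar>
     \<le> (LINT t:{a<..}|lborel. (w t * tail a t - 4 * tail a t) + r t)"
  proof -
    have int: "set_integrable lborel {a<..} (\<lambda>t. (w t * tail a t - 4 * tail a t) + r t)"
      using wi rm by (rule set_integral_add)
    have "set_integrable lborel {a<..} (\<lambda>t. cos (t * x) * ((16 * t\<^sup>2 + 16 * t - 4) * tail a t))"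
      using int unfolding set_integrable_def
      by (rule Bochner_Integration.integrable_bound)
         (use pw in \<open>auto split: split_indicator intro: order_trans[OF _ abs_ge_self]\<close>)
    then have "norm (LINT t:{a<..}|lborel. cos (t * x) * ((16 * t\<^sup>2 + 16 * t - 4) * tail a t))
       \<le> (LINT t:{a<..}|lborel. norm (cos (t * x) * ((16 * t\<^sup>2 + 16 * t - 4) * tail a t)))"
      by (rule set_integral_norm_bound)
    also have "\<dots> \<le> (LINT t:{a<..}|lborel. (w t * tail a t - 4 * tail a t) + r t)"
      using \<open>set_integrable lborel {a<..} (\<lambda>t. cos (t * x) * _ t)\<close>
      by (intro set_integral_mono set_integrable_norm int) (use pw in auto)
    finally show ?thesis by simp
  qed
  also have "\<dots> = (2 + 4 * a) * exp (- 2 * a) - 4 * (LINT t:{a<..}|lborel. tail a t)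
      + (max 0 (1 - 4 * a))\<^sup>2 * exp (- 2 * a)"
    using wi rm by (simp only: set_integral_add wI rI)
  \<comment> \<open>The amount 4a exp (- 2a) is set aside here, so that it can absorb the boundary
    term of the kink in \<open>cos_transform_bounds\<close>.\<close>
  also have "\<dots> \<le> (2 + 8 * a - (1 + 2 * a) / (1 + 2 * a + 2 * a\<^sup>2) + (max 0 (1 - 4 * a))\<^sup>2) * exp (- 2 * a)
      - 4 * a * exp (- 2 * a)"
    using tail_integral_ge[OF a] by (simp add: left_diff_distrib distrib_right)
  also have "\<dots> \<le> 2 - 4 * a * exp (- 2 * a)"
    using tail_bound_polynomial[OF a] by simp
  finally show ?thesis .
qed

text \<open>The boundary term is at most 4a exp (- 2a) and the tail integral at most 2 - 4a exp (-
  2a) in absolute value. Together they deviate from the main term 2 by at most 2, whatever a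
  is.\<close>

lemma cos_transform_bounds:
  fixes a x :: real
  assumes a: "0 \<le> a"
  defines "T \<equiv> (LINT t:{0..a}|lborel. cos (t * x) * exp (- 2 * t)) + (LINT t:{a<..}|lborel. cos (t * x) * tail a t)"
  shows "0 \<le> T" "T \<le> 4 / (4 + x\<^sup>2)"
proof -
  have "\<bar>4 * a * cos (a * x) * exp (- 2 * a)\<bar> \<le> 4 * a * exp (- 2 * a)"
  proof -
    have "\<bar>cos (a * x)\<bar> * (4 * a * exp (- 2 * a)) \<le> 4 * a * exp (- 2 * a)"
      using a by (intro mult_left_le_one_le) auto
    then show ?thesis using a by (simp add: abs_mult mult_ac)
  qed
  then have "\<bar>(4 + x\<^sup>2) * T - 2\<bar> \<le> 2"
    unfolding T_def cos_transform[OF a] using abs_cos_tail_integral_le[OF a, of x] by linarith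
  then have b: "0 \<le> (4 + x\<^sup>2) * T" "(4 + x\<^sup>2) * T \<le> 4" by linarith+
  have p: "0 < 4 + x\<^sup>2" using zero_le_power2[of x] by linarith
  show "0 \<le> T" using b(1) p by (simp add: zero_le_mult_iff)
  show "T \<le> 4 / (4 + x\<^sup>2)" using b(2) p by (simp add: pos_le_divide_eq mult.commute)
qed

subsection \<open>The density\<close>

text \<open>The product of the s-free modulus exp (- 2|u| - u^2) with an unnormalized Laplace
  density centred at u^2. In this form evenness, continuity and measurability are immediate; the
  piecewise form appears in \<open>ker_eq\<close>.\<close>

definition ker :: "real \<Rightarrow> real \<Rightarrow> real" where
  "ker y u = exp (- 2 * \<bar>u\<bar> - u\<^sup>2 - \<bar>y - u\<^sup>2\<bar>)"

text \<open>Divided by 4 pi, this becomes the density at the point (x, y). The ordinate comes first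
  since it is the parameter of the kernel, hence the swapped projections in later uses.\<close>

definition cosker :: "real \<Rightarrow> real \<Rightarrow> real" where
  "cosker y x = (LINT u|lborel. cos (u * x) * ker y u)"

lemma ker_measurable [measurable]: "ker y \<in> borel_measurable borel"
  unfolding ker_def[abs_def] by measurable

lemma ker_even: "ker y (- u) = ker y u" by (simp add: ker_def)

lemma ker_pos: "0 < ker y u" by (simp add: ker_def)

lemma ker_le: "ker y u \<le> exp (- 2 * \<bar>u\<bar>)"
proof -
  have "- 2 * \<bar>u\<bar> - u\<^sup>2 - \<bar>y - u\<^sup>2\<bar> \<le> - 2 * \<bar>u\<bar>"
    using zero_le_power2[of u] by linarith
  then show ?thesis unfolding ker_def by (simp only: exp_le_cancel_iff)
qed

lemma ker_factor: "ker y u = exp (- 2 * \<bar>u\<bar> - u\<^sup>2) * exp (- \<bar>y - u\<^sup>2\<bar>)"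
  by (simp add: ker_def exp_add[symmetric])

lemma integrable_ker: "integrable lborel (ker y)"
  by (rule Bochner_Integration.integrable_bound[OF integrable_exp_abs[of 2]])
     (use ker_le ker_pos in \<open>auto simp: less_imp_le\<close>)

text \<open>For u^2 <= y the exponent - u^2 - (y - u^2) collapses to - y; for larger u it is y -
  2u^2, which is - |y| + 2 max y 0 - 2u^2 for either sign of y. If y <= 0, the first branch contains
  only u = 0.\<close>

lemma ker_eq:
  fixes y :: real
  defines "a \<equiv> sqrt (max y 0)"
  assumes "0 \<le> u"
  shows "ker y u = exp (- \<bar>y\<bar>) * (if u \<le> a then exp (- 2 * u) else tail a u)"
proof (cases "u \<le> a")
  case True
  have "u\<^sup>2 \<le> max y 0"
    using power_mono[OF True assms(2), of 2] by (simp add: a_def)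
  then have "- u\<^sup>2 - \<bar>y - u\<^sup>2\<bar> = - \<bar>y\<bar>"
    using zero_le_power2[of u] by (cases "0 \<le> y") (auto simp: max_def abs_if)
  then show ?thesis using True assms by (simp add: ker_def exp_add[symmetric])
next
  case False
  have a2: "a\<^sup>2 = max y 0" by (simp add: a_def)
  have "0 \<le> a" by (simp add: a_def)
  then have "max y 0 < u\<^sup>2"
    using False power_strict_mono[of a u 2] by (simp add: a2)
  then have "y < u\<^sup>2" by simp
  then have "- u\<^sup>2 - \<bar>y - u\<^sup>2\<bar> = - \<bar>y\<bar> + (2 * max y 0 - 2 * u\<^sup>2)"
    by (cases "0 \<le> y") (simp_all add: max_def)
  then show ?thesis using False assms by (simp add: ker_def tail_def a2 exp_add[symmetric])
qed

lemma cosker_eq: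
  fixes y :: real
  defines "a \<equiv> sqrt (max y 0)"
  shows "cosker y x = 2 * exp (- \<bar>y\<bar>) * ((LINT t:{0..a}|lborel. cos (t * x) * exp (- 2 * t))
     + (LINT t:{a<..}|lborel. cos (t * x) * tail a t))"
proof -
  have a: "0 \<le> a" by (simp add: a_def)
  have "set_integrable lborel {0..a} (\<lambda>t. cos (t * x) * exp (- 2 * t))"
    by (intro borel_integrable_atLeastAtMost' continuous_intros)
  moreover have "set_integrable lborel {a<..} (\<lambda>t. cos (t * x) * tail a t)"
    using integrable_tail[OF a] unfolding set_integrable_def
    by (rule Bochner_Integration.integrable_bound)
       (auto simp: abs_mult mult_left_le_one_le split: split_indicator)
  ultimately have "has_bochner_integral lborel
      (\<lambda>t. exp (- \<bar>y\<bar>) * (indicator {0..a} t *\<^sub>R (cos (t * x) * exp (- 2 * t))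
          + indicator {a<..} t *\<^sub>R (cos (t * x) * tail a t)))
      (exp (- \<bar>y\<bar>) * ((LINT t:{0..a}|lborel. cos (t * x) * exp (- 2 * t))
     + (LINT t:{a<..}|lborel. cos (t * x) * tail a t)))"
    unfolding set_integrable_def set_lebesgue_integral_def
    by (intro has_bochner_integral_mult_right has_bochner_integral_add)
       (simp_all add: has_bochner_integral_integrable)
  also have "(\<lambda>t. exp (- \<bar>y\<bar>) * (indicator {0..a} t *\<^sub>R (cos (t * x) * exp (- 2 * t))
          + indicator {a<..} t *\<^sub>R (cos (t * x) * tail a t)))
      = (\<lambda>t. indicator {0..} t *\<^sub>R (cos (t * x) * ker y t))"
    using a by (auto simp: fun_eq_iff ker_eq a_def[symmetric] split: split_indicator)
  finally have "has_bochner_integral lborel (\<lambda>t. cos (t * x) * ker y t)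
      (2 *\<^sub>R (exp (- \<bar>y\<bar>) * ((LINT t:{0..a}|lborel. cos (t * x) * exp (- 2 * t))
     + (LINT t:{a<..}|lborel. cos (t * x) * tail a t))))"
    by (rule has_bochner_integral_even_function) (simp add: ker_even)
  then show ?thesis
    unfolding cosker_def by (simp add: has_bochner_integral_iff)
qed

lemma cosker_nonneg: "0 \<le> cosker y x"
  unfolding cosker_eq using cos_transform_bounds(1)[of "sqrt (max y 0)" x] by simp

text \<open>A product bound that is integrable in each variable: it makes the transform integrable
  in x, as inversion requires, and the future density integrable on the plane, as Fubini
  requires.\<close>

lemma cosker_le: "cosker y x \<le> 8 * exp (- \<bar>y\<bar>) * (1 / (4 + x\<^sup>2))"
  unfolding cosker_eq
  using mult_left_mono[OF cos_transform_bounds(2)[of "sqrt (max y 0)" x], of "2 * exp (- \<bar>y\<bar>)"] by simp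

lemma cosker_measurable [measurable]:
  "(\<lambda>z. cosker (fst z) (snd z)) \<in> borel_measurable (borel \<Otimes>\<^sub>M borel)"
proof -
  have "(\<lambda>(z, u). cos (u * snd z) * ker (fst z) u) \<in> borel_measurable ((borel \<Otimes>\<^sub>M borel) \<Otimes>\<^sub>M lborel)"
    unfolding ker_def by measurable
  then show ?thesis unfolding cosker_def
    by (intro sigma_finite_measure.borel_measurable_lebesgue_integral) (simp_all add: sigma_finite_lborel)
qed

lemma integrable_cosker: "integrable lborel (cosker y)"
proof (rule Bochner_Integration.integrable_bound)
  show "integrable lborel (\<lambda>x. 8 * exp (- \<bar>y\<bar>) * (1 / (4 + x\<^sup>2)))"
    by (intro integrable_mult_right integrable_inverse_4_plus_square)
  show "cosker y \<in> borel_measurable lborel"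
    using measurable_compose[OF _ cosker_measurable, of "\<lambda>x. (y, x)" lborel] by simp
  show "AE x in lborel. norm (cosker y x) \<le> norm (8 * exp (- \<bar>y\<bar>) * (1 / (4 + x\<^sup>2)))"
    using cosker_le cosker_nonneg by (intro AE_I2) (metis abs_ge_self abs_of_nonneg order_trans real_norm_def)
qed

lemma fourier_cosker: "(CLINT x|lborel. iexp (t * x) * of_real (cosker y x)) = of_real (2 * pi * ker y t)"
proof -
  have h: "(CLINT u|lborel. iexp (- (u * x)) * of_real (ker y u)) = of_real (cosker y x)" for x
    using fourier_even[OF integrable_ker ker_even, of "- x" y] by (simp add: cosker_def)
  have "(CLINT x|lborel. iexp (t * x) * (CLINT u|lborel. iexp (- (u * x)) * of_real (ker y u)))
      = of_real (2 * pi) * of_real (ker y t)"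
  proof (rule fourier_inversion)
    show "integrable lborel (\<lambda>u. complex_of_real (ker y u))"
      using integrable_ker by simp
    show "cmod (complex_of_real (ker y u)) \<le> 1" for u
      using order_trans[OF ker_le[of y u], of 1] ker_pos[of y u] by simp
    show "isCont (\<lambda>u. complex_of_real (ker y u)) t"
      unfolding ker_def by (intro continuous_intros)
    show "integrable lborel (\<lambda>x. CLINT u|lborel. iexp (- (u * x)) * complex_of_real (ker y u))"
      unfolding h using integrable_cosker by simp
  qed
  then show ?thesis unfolding h by simp
qed

lemma integrable_cosker_pair:
  "integrable (lborel \<Otimes>\<^sub>M lborel) (\<lambda>z. cosker (snd z) (fst z))"
proof (rule Bochner_Integration.integrable_bound)
  show "integrable (lborel \<Otimes>\<^sub>M lborel) (\<lambda>z :: real \<times> real. 8 * exp (- \<bar>snd z\<bar>) * (1 / (4 + (fst z)\<^sup>2)))"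
  proof (rule lborel_pair.Fubini_integrable)
    have e: "integrable lborel (\<lambda>y :: real. exp (- \<bar>y\<bar>))" using integrable_exp_abs[of 1] by simp
    have "(\<lambda>x :: real. LINT y|lborel. norm (8 * exp (- \<bar>snd (x, y :: real)\<bar>) * (1 / (4 + (fst (x, y))\<^sup>2))))
       = (\<lambda>x. 8 * (LINT y|lborel. exp (- \<bar>y :: real\<bar>)) * (1 / (4 + x\<^sup>2)))"
      by (simp add: add_nonneg_nonneg fun_eq_iff abs_of_nonneg)
    then show "integrable lborel (\<lambda>x :: real. LINT y|lborel. norm (8 * exp (- \<bar>snd (x, y :: real)\<bar>) * (1 / (4 + (fst (x, y))\<^sup>2))))"
      using integrable_inverse_4_plus_square by (simp only: integrable_mult_right)
    show "AE x in lborel. integrable lborel (\<lambda>y. 8 * exp (- \<bar>snd (x, y :: real)\<bar>) * (1 / (4 + (fst (x :: real, y))\<^sup>2)))"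
      using e by (intro AE_I2) (simp only: fst_conv snd_conv integrable_mult_left integrable_mult_right)
  qed measurable
  show "(\<lambda>z. cosker (snd z) (fst z)) \<in> borel_measurable (lborel \<Otimes>\<^sub>M lborel)"
    using measurable_compose[OF _ cosker_measurable, of "\<lambda>z. (snd z, fst z)" "lborel \<Otimes>\<^sub>M lborel"] by simp
  show "AE z in lborel \<Otimes>\<^sub>M lborel. norm (cosker (snd z) (fst z)) \<le> norm (8 * exp (- \<bar>snd z\<bar>) * (1 / (4 + (fst z)\<^sup>2)))"
    using cosker_le cosker_nonneg by (intro AE_I2) (metis abs_ge_self abs_of_nonneg order_trans real_norm_def)
qed

text \<open>Integrating over x first, inversion returns the kernel, which as a function of y is a
  Laplace kernel centred at t^2. Recentring it at 0 releases the phase. The constant is 2 pi from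
  inversion times the mass 2 of exp (- |z|).\<close>

lemma fourier_cosker_pair:
  "(CLINT z|lborel \<Otimes>\<^sub>M lborel. iexp (t * fst z + s * snd z) * of_real (cosker (snd z) (fst z)))
     = of_real (4 * pi) * target_char t s"
proof -
  have [measurable]: "(\<lambda>z. cosker (snd z) (fst z)) \<in> borel_measurable (borel \<Otimes>\<^sub>M borel)"
    using measurable_compose[OF _ cosker_measurable, of "\<lambda>z. (snd z, fst z)" "borel \<Otimes>\<^sub>M borel"] by simp
  have int: "integrable (lborel \<Otimes>\<^sub>M lborel)
      (\<lambda>(x, y). iexp (t * x + s * y) * of_real (cosker y x))"
    by (rule Bochner_Integration.integrable_bound[OF integrable_cosker_pair])
       (auto simp: norm_mult split_beta simp del: of_real_add of_real_mult)
  have "(CLINT z|lborel \<Otimes>\<^sub>M lborel. iexp (t * fst z + s * snd z) * of_real (cosker (snd z) (fst z)))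
      = (CLINT y|lborel. CLINT x|lborel. iexp (t * x + s * y) * of_real (cosker y x))"
    unfolding lborel_pair.integral_snd[OF int] split_beta' ..
  also have "\<dots> = (CLINT y|lborel. iexp (s * y) * (CLINT x|lborel. iexp (t * x) * of_real (cosker y x)))"
  proof -
    have "iexp (t * x + s * y) * of_real (cosker y x) = iexp (s * y) * (iexp (t * x) * of_real (cosker y x))" for x y
      by (simp add: exp_add distrib_left)
    then show ?thesis by (simp only: integral_mult_right_zero)
  qed
  also have "\<dots> = (CLINT y|lborel. of_real (2 * pi * exp (- 2 * \<bar>t\<bar> - t\<^sup>2)) * (iexp (s * y) * of_real (exp (- \<bar>y - t\<^sup>2\<bar>))))"
    unfolding fourier_cosker ker_factor by (simp only: of_real_mult mult_ac)
  also have "\<dots> = of_real (2 * pi * exp (- 2 * \<bar>t\<bar> - t\<^sup>2)) * (CLINT y|lborel. iexp (s * y) * of_real (exp (- \<bar>y - t\<^sup>2\<bar>)))"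
    by (rule integral_mult_right_zero)
  also have "(CLINT y|lborel. iexp (s * y) * of_real (exp (- \<bar>y - t\<^sup>2\<bar>)))
      = (CLINT z|lborel. iexp (s * (t\<^sup>2 + z)) * of_real (exp (- \<bar>z\<bar>)))"
    by (subst lborel_integral_real_affine[where c=1 and t="t\<^sup>2"]) simp_all
  also have "\<dots> = (CLINT z|lborel. iexp (t\<^sup>2 * s) * (iexp (z * s) * of_real (exp (- \<bar>z\<bar>))))"
    by (intro Bochner_Integration.integral_cong) (simp_all add: exp_add distrib_left mult_ac)
  also have "\<dots> = iexp (t\<^sup>2 * s) * of_real (2 / (1 + s\<^sup>2))"
    unfolding integral_mult_right_zero fourier_laplace ..
  also have "of_real (2 * pi * exp (- 2 * \<bar>t\<bar> - t\<^sup>2)) * (iexp (t\<^sup>2 * s) * of_real (2 / (1 + s\<^sup>2)))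
      = of_real (4 * pi) * target_char t s"
  proof -
    have "target_char t s = of_real (exp (- 2 * \<bar>t\<bar> - t\<^sup>2)) * iexp (t\<^sup>2 * s) / of_real (1 + s\<^sup>2)"
      unfolding target_char_def exp_add exp_of_real ..
    then show ?thesis by simp
  qed
  finally show ?thesis .
qed

lemma target_char_is_char2:
  "\<exists>\<mu> :: (real \<times> real) measure.
      prob_space \<mu> \<and> sets \<mu> = sets borel \<and> (\<forall>t s. char2 \<mu> t s = target_char t s)"
proof -
  define p where "p z = cosker (snd z) (fst z) / (4 * pi)" for z
  define \<mu> where "\<mu> = density (lborel \<Otimes>\<^sub>M lborel) (\<lambda>z. ennreal (p z))"
  have p0: "0 \<le> p z" for z using cosker_nonneg by (simp add: p_def)
  have pI: "integrable (lborel \<Otimes>\<^sub>M lborel) p"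
    unfolding p_def[abs_def] using integrable_cosker_pair by simp
  then have [measurable]: "p \<in> borel_measurable (borel \<Otimes>\<^sub>M borel)"
    using borel_measurable_integrable[OF pI] by (simp cong: measurable_cong_sets)
  have ch: "(CLINT z|(lborel \<Otimes>\<^sub>M lborel). p z *\<^sub>R iexp (t * fst z + s * snd z)) = target_char t s" for t s
  proof -
    have "(CLINT z|(lborel \<Otimes>\<^sub>M lborel). p z *\<^sub>R iexp (t * fst z + s * snd z))
        = (CLINT z|lborel \<Otimes>\<^sub>M lborel. (1 / of_real (4 * pi)) * (iexp (t * fst z + s * snd z) * of_real (cosker (snd z) (fst z))))"
      by (intro Bochner_Integration.integral_cong) (simp_all add: p_def scaleR_conv_of_real)
    also have "\<dots> = (1 / of_real (4 * pi)) * (of_real (4 * pi) * target_char t s)"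
      unfolding integral_mult_right_zero fourier_cosker_pair ..
    finally show ?thesis by simp
  qed
  \<comment> \<open>The total mass is the transform at the origin, where \<open>target_char\<close>
    equals 1; no separate computation of the normalization is required.\<close>
  have "complex_of_real (LINT z|(lborel \<Otimes>\<^sub>M lborel). p z) = target_char 0 0"
    unfolding ch[symmetric] integral_complex_of_real[symmetric]
    by (intro Bochner_Integration.integral_cong) (simp_all add: scaleR_conv_of_real)
  then have p1: "(LINT z|(lborel \<Otimes>\<^sub>M lborel). p z) = 1"
    by (simp add: target_char_def)
  have "emeasure \<mu> (space \<mu>) = (\<integral>\<^sup>+z. ennreal (p z) \<partial>(lborel \<Otimes>\<^sub>M lborel))"
    unfolding \<mu>_def space_density using borel_measurable_integrable[OF pI]
    by (subst emeasure_density[OF _ sets.top]) (auto intro!: nn_integral_cong)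
  also have "\<dots> = 1"
    using nn_integral_eq_integral[OF pI] p0 p1 by simp
  finally have "prob_space \<mu>" by (rule prob_spaceI)
  moreover have "sets \<mu> = sets borel"
    unfolding \<mu>_def borel_prod[symmetric] by (simp cong: sets_pair_measure_cong)
  moreover have "char2 \<mu> t s = target_char t s" for t s
    unfolding char2_def ch[symmetric] \<mu>_def by (rule integral_density) (use p0 in auto)
  ultimately show ?thesis by blast
qed

subsection \<open>Independence and joint characteristic functions\<close>

text \<open>By uniqueness of characteristic functions, reweighting by w does not change the law of U. Applied with
  w = 2 + cos (sV) and w = 2 + sin (sV), and then with the roles of U and V exchanged and w the indicator
  of an event in terms of U, this reduces uniqueness in two dimensions to one dimension.\<close>

lemma (in prob_space) weighted_char_factor:
  fixes U w :: "'a \<Rightarrow> real"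
  assumes U [measurable]: "U \<in> borel_measurable M"
    and w: "integrable M w" "\<And>\<omega>. 0 \<le> w \<omega>"
    and fac: "\<And>t. (CLINT \<omega>|M. iexp (t * U \<omega>) * of_real (w \<omega>))
                = (CLINT \<omega>|M. iexp (t * U \<omega>)) * of_real (\<integral>\<omega>. w \<omega> \<partial>M)"
    and A [measurable]: "A \<in> sets borel"
  shows "(\<integral>\<omega>. indicator A (U \<omega>) * w \<omega> \<partial>M) = (\<integral>\<omega>. indicator A (U \<omega>) \<partial>M) * (\<integral>\<omega>. w \<omega> \<partial>M)"
proof (cases "(\<integral>\<omega>. w \<omega> \<partial>M) = 0")
  case True
  then have "AE \<omega> in M. w \<omega> = 0"
    using integral_nonneg_eq_0_iff_AE[OF w(1)] w(2) by auto
  then have "(\<integral>\<omega>. indicator A (U \<omega>) * w \<omega> \<partial>M) = (\<integral>\<omega>. 0 \<partial>M)"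
    using borel_measurable_integrable[OF w(1)] by (intro integral_cong_AE) (auto)
  then show ?thesis using True by simp
next
  case False
  define c where "c = (\<integral>\<omega>. w \<omega> \<partial>M)"
  have c: "c > 0" using False w(2) by (simp add: c_def less_le integral_nonneg)
  have wm [measurable]: "w \<in> borel_measurable M" using w(1) by auto
  define N where "N = density M (\<lambda>\<omega>. ennreal (w \<omega> / c))"
  have "emeasure N (space N) = (\<integral>\<^sup>+\<omega>. ennreal (w \<omega> / c) \<partial>M)"
    unfolding N_def by (simp add: emeasure_density cong: nn_integral_cong)
  also have "\<dots> = ennreal (\<integral>\<omega>. w \<omega> / c \<partial>M)"
    using w c by (intro nn_integral_eq_integral) auto
  also have "\<dots> = 1" using c by (simp add: c_def)
  finally interpret N: prob_space N by (rule prob_spaceI)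
  have UN [measurable]: "U \<in> borel_measurable N" by (simp add: N_def)
  have "distr N borel U = distr M borel U"
  proof (rule Levy_uniqueness)
    show "real_distribution (distr N borel U)" by (rule N.real_distribution_distr[OF UN])
    show "real_distribution (distr M borel U)" by (rule real_distribution_distr[OF U])
    show "char (distr N borel U) = char (distr M borel U)"
    proof
      fix t
      have "char (distr N borel U) t = (CLINT \<omega>|N. iexp (t * U \<omega>))"
        by (simp add: char_def integral_distr)
      also have "\<dots> = (CLINT \<omega>|M. (w \<omega> / c) *\<^sub>R iexp (t * U \<omega>))"
        unfolding N_def using w(2) c by (subst integral_density) auto
      also have "\<dots> = (CLINT \<omega>|M. (iexp (t * U \<omega>) * of_real (w \<omega>)) / of_real c)"
        by (intro Bochner_Integration.integral_cong) (auto simp: scaleR_conv_of_real)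
      also have "\<dots> = (CLINT \<omega>|M. iexp (t * U \<omega>))"
        using c by (simp add: fac[unfolded of_real_mult] c_def[symmetric])
      also have "\<dots> = char (distr M borel U) t"
        by (simp add: char_def integral_distr)
      finally show "char (distr N borel U) t = char (distr M borel U) t" .
    qed
  qed
  then have "(\<integral>x. (indicator A x :: real) \<partial>distr N borel U) = (\<integral>x. indicator A x \<partial>distr M borel U)"
    by simp
  then have "(\<integral>\<omega>. (indicator A (U \<omega>) :: real) \<partial>N) = (\<integral>\<omega>. indicator A (U \<omega>) \<partial>M)"
    by (subst (asm) (1 2) integral_distr) auto
  moreover have "(\<integral>\<omega>. (indicator A (U \<omega>) :: real) \<partial>N) = (\<integral>\<omega>. indicator A (U \<omega>) * w \<omega> \<partial>M) / c"
    unfolding N_def using w(2) c by (subst integral_density) (auto simp: mult.commute)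
  ultimately show ?thesis using c by (simp add: c_def field_simps)
qed

lemma (in prob_space) indep_var_of_joint_char:
  fixes U V :: "'a \<Rightarrow> real"
  assumes U [measurable]: "U \<in> borel_measurable M" and V [measurable]: "V \<in> borel_measurable M"
    and fac: "\<And>t s. joint_char U V t s = joint_char U V t 0 * joint_char U V 0 s"
  shows "indep_var borel U borel V"
proof -
  have ci: "integrable M (\<lambda>\<omega>. iexp (t * U \<omega> + s * V \<omega>))" for t s
    by (rule integrable_const_bound[of _ 1]) auto
  have Ui: "integrable M (\<lambda>\<omega>. iexp (t * U \<omega>))" for t
    by (rule integrable_const_bound[of _ 1]) auto
  have Vi: "integrable M (\<lambda>\<omega>. iexp (s * V \<omega>))" for s
    by (rule integrable_const_bound[of _ 1]) auto
  have fac': "(CLINT \<omega>|M. iexp (t * U \<omega>) * iexp (s * V \<omega>))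
      = (CLINT \<omega>|M. iexp (t * U \<omega>)) * (CLINT \<omega>|M. iexp (s * V \<omega>))" for t s
    using fac[of t s] by (simp add: joint_char_def exp_add[symmetric] distrib_left)
  have UVi: "integrable M (\<lambda>\<omega>. iexp (t * U \<omega>) * iexp (s * V \<omega>))" for t s
    using ci[of t s] by (simp add: exp_add[symmetric] distrib_left)
  have cosE: "complex_of_real (cos x) = (iexp x + iexp (-x)) / 2" for x
    by (simp add: cos_of_real[symmetric] cos_exp_eq del: cos_of_real)
  have sinE: "complex_of_real (sin x) = (iexp x - iexp (-x)) / (2 * \<i>)" for x
    by (simp add: sin_of_real[symmetric] sin_exp_eq del: sin_of_real)
  \<comment> \<open>A cosine or sine of s V is a combination of the exponentials with frequencies s
    and -s, so factorization at these two frequencies passes to the weight by linearity. The summand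
    2 is carried along because the weight must be nonnegative.\<close>
  have lin: "(CLINT \<omega>|M. iexp (t * U \<omega>) * of_real (2 + f (s * V \<omega>)))
      = (CLINT \<omega>|M. iexp (t * U \<omega>)) * of_real (\<integral>\<omega>. 2 + f (s * V \<omega>) \<partial>M)"
    if f: "\<And>x. complex_of_real (f x) = (a * iexp x + b * iexp (-x))" for f a b t s
  proof -
    have e: "of_real (2 + f (s * V \<omega>)) = 2 + (a * iexp (s * V \<omega>) + b * iexp ((-s) * V \<omega>))" for \<omega>
      using f[of "s * V \<omega>"] by simp
    have "complex_of_real (\<integral>\<omega>. 2 + f (s * V \<omega>) \<partial>M)
        = (CLINT \<omega>|M. 2 + (a * iexp (s * V \<omega>) + b * iexp ((-s) * V \<omega>)))"
      unfolding e[symmetric] by (simp only: integral_complex_of_real)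
    also have "\<dots> = 2 + (a * (CLINT \<omega>|M. iexp (s * V \<omega>)) + b * (CLINT \<omega>|M. iexp ((-s) * V \<omega>)))"
      using Vi[of s] Vi[of "-s"] by (simp add: prob_space)
    finally have R: "complex_of_real (\<integral>\<omega>. 2 + f (s * V \<omega>) \<partial>M) = \<dots>" .
    have "(CLINT \<omega>|M. iexp (t * U \<omega>) * of_real (2 + f (s * V \<omega>)))
       = (CLINT \<omega>|M. 2 * iexp (t * U \<omega>) + (a * (iexp (t * U \<omega>) * iexp (s * V \<omega>))
             + b * (iexp (t * U \<omega>) * iexp ((-s) * V \<omega>))))"
      unfolding e by (simp add: algebra_simps)
    also have "\<dots> = 2 * (CLINT \<omega>|M. iexp (t * U \<omega>)) + (a * (CLINT \<omega>|M. iexp (t * U \<omega>) * iexp (s * V \<omega>))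
             + b * (CLINT \<omega>|M. iexp (t * U \<omega>) * iexp ((-s) * V \<omega>)))"
      by (subst Bochner_Integration.integral_add integral_mult_right_zero,
          (intro integrable_mult_right Bochner_Integration.integrable_add Ui UVi)+)+ 
         (simp only: integral_mult_right_zero)
    also have "\<dots> = (CLINT \<omega>|M. iexp (t * U \<omega>)) * of_real (\<integral>\<omega>. 2 + f (s * V \<omega>) \<partial>M)"
      unfolding R fac' by (simp add: algebra_simps)
    finally show ?thesis .
  qed
  have bnd: "integrable M (\<lambda>\<omega>. f (s * V \<omega>))" if "f = cos \<or> f = sin" for f :: "real \<Rightarrow> real" and s
    using that by (intro integrable_const_bound[of _ 1]) auto
  have wt: "(\<integral>\<omega>. indicator A (U \<omega>) * f (s * V \<omega>) \<partial>M) = (\<integral>\<omega>. indicator A (U \<omega>) \<partial>M) * (\<integral>\<omega>. f (s * V \<omega>) \<partial>M)"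
    if A [measurable]: "A \<in> sets borel" and f: "f = cos \<or> f = sin" for A s and f :: "real \<Rightarrow> real"
  proof -
    have ex: "\<exists>a b. \<forall>x. complex_of_real (f x) = (a * iexp x + b * iexp (-x))"
      using f
    proof
      assume "f = cos" then show ?thesis
        by (intro exI[of _ "1/2"]) (simp add: cosE field_simps del: cos_of_real)
    next
      assume "f = sin" then show ?thesis
        by (intro exI[of _ "1/(2*\<i>)"] exI[of _ "-1/(2*\<i>)"]) (simp add: sinE field_simps del: sin_of_real)
    qed
    then obtain a b where ab: "\<And>x. complex_of_real (f x) = (a * iexp x + b * iexp (-x))" by blast
    have ge: "- 1 \<le> f x" for x using f by (elim disjE) (simp_all)
    have [measurable]: "f \<in> borel_measurable borel" using f by auto
    \<comment> \<open>The constant 2 contributes the same amount to both sides and is subtracted at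
      the end, which leaves the factorization for the signed function \<open>f\<close>
      itself.\<close>
    have 1: "(\<integral>\<omega>. indicator A (U \<omega>) * (2 + f (s * V \<omega>)) \<partial>M)
       = (\<integral>\<omega>. indicator A (U \<omega>) \<partial>M) * (\<integral>\<omega>. 2 + f (s * V \<omega>) \<partial>M)"
    proof (rule weighted_char_factor)
      show "integrable M (\<lambda>\<omega>. 2 + f (s * V \<omega>))" using bnd[OF f] by simp
      show "0 \<le> 2 + f (s * V \<omega>)" for \<omega> using ge[of "s * V \<omega>"] by simp
    qed (use lin[OF ab] in auto)
    have I: "integrable M (\<lambda>\<omega>. indicator A (U \<omega>) :: real)"
      by (intro integrable_const_bound[of _ 1]) auto
    have J: "integrable M (\<lambda>\<omega>. indicator A (U \<omega>) * f (s * V \<omega>))"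
      by (rule Bochner_Integration.integrable_bound[OF bnd[OF f, of s]]) (auto split: split_indicator)
    have "(\<integral>\<omega>. indicator A (U \<omega>) * (2 + f (s * V \<omega>)) \<partial>M)
        = (\<integral>\<omega>. 2 * indicator A (U \<omega>) + indicator A (U \<omega>) * f (s * V \<omega>) \<partial>M)"
      by (simp add: algebra_simps)
    also have "\<dots> = 2 * (\<integral>\<omega>. indicator A (U \<omega>) \<partial>M) + (\<integral>\<omega>. indicator A (U \<omega>) * f (s * V \<omega>) \<partial>M)"
      using I J by simp
    finally show ?thesis using 1 bnd[OF f, of s] by (simp add: prob_space algebra_simps)
  qed
  have main: "(\<integral>\<omega>. indicator B (V \<omega>) * indicator A (U \<omega>) \<partial>M)
     = (\<integral>\<omega>. indicator B (V \<omega>) \<partial>M) * (\<integral>\<omega>. indicator A (U \<omega>) \<partial>M :: real)"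
    if A [measurable]: "A \<in> sets borel" and B: "B \<in> sets borel" for A B
  proof (rule weighted_char_factor)
    have I: "integrable M (\<lambda>\<omega>. indicator A (U \<omega>) :: real)"
      by (intro integrable_const_bound[of _ 1]) auto
    then show "integrable M (\<lambda>\<omega>. indicator A (U \<omega>) :: real)" .
    fix t
    have J: "integrable M (\<lambda>\<omega>. indicator A (U \<omega>) * f (t * V \<omega>))" if "f = cos \<or> f = sin" for f :: "real \<Rightarrow> real"
      by (rule Bochner_Integration.integrable_bound[OF bnd[OF that, of t]]) 
         (use that in \<open>auto split: split_indicator\<close>)
    have K: "iexp (t * V \<omega>) = of_real (cos (t * V \<omega>)) + \<i> * of_real (sin (t * V \<omega>))" for \<omega>
      by (metis cis_conv_exp complex_eq cis.sel mult.commute)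
    have "(CLINT \<omega>|M. iexp (t * V \<omega>) * of_real (indicator A (U \<omega>)))
       = (CLINT \<omega>|M. of_real (indicator A (U \<omega>) * cos (t * V \<omega>)) + \<i> * of_real (indicator A (U \<omega>) * sin (t * V \<omega>)))"
      unfolding K by (intro Bochner_Integration.integral_cong) (auto simp: algebra_simps)
    also have "\<dots> = of_real (\<integral>\<omega>. indicator A (U \<omega>) * cos (t * V \<omega>) \<partial>M) 
         + \<i> * of_real (\<integral>\<omega>. indicator A (U \<omega>) * sin (t * V \<omega>) \<partial>M)"
      using J[of cos] J[of sin]
      by (subst Bochner_Integration.integral_add) (auto simp del: of_real_mult intro!: integrable_of_real)
    also have "\<dots> = of_real (\<integral>\<omega>. indicator A (U \<omega>) \<partial>M) 
        * (of_real (\<integral>\<omega>. cos (t * V \<omega>) \<partial>M) + \<i> * of_real (\<integral>\<omega>. sin (t * V \<omega>) \<partial>M))"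
      using A by (simp add: wt algebra_simps)
    also have "(of_real (\<integral>\<omega>. cos (t * V \<omega>) \<partial>M) + \<i> * of_real (\<integral>\<omega>. sin (t * V \<omega>) \<partial>M))
       = (CLINT \<omega>|M. iexp (t * V \<omega>))"
      unfolding K using bnd[of cos t] bnd[of sin t]
      by (subst Bochner_Integration.integral_add) (auto simp del: of_real_mult intro!: integrable_of_real)
    finally show "(CLINT \<omega>|M. iexp (t * V \<omega>) * of_real (indicator A (U \<omega>)))
       = (CLINT \<omega>|M. iexp (t * V \<omega>)) * of_real (\<integral>\<omega>. indicator A (U \<omega>) \<partial>M)"
      by simp
  qed (use B in auto)
  show ?thesis
    unfolding indep_var_distribution_eq
  proof (intro conjI U V)
    interpret DU: prob_space "distr M borel U" by (rule prob_space_distr) simp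
    interpret DV: prob_space "distr M borel V" by (rule prob_space_distr) simp
    show "distr M borel U \<Otimes>\<^sub>M distr M borel V = distr M (borel \<Otimes>\<^sub>M borel) (\<lambda>x. (U x, V x))"
    proof (rule pair_measure_eqI)
      fix A B assume "A \<in> sets (distr M borel U)" "B \<in> sets (distr M borel V)"
      then have [measurable]: "A \<in> sets borel" "B \<in> sets borel" by auto
      have r: "measure (distr M borel V) B = (\<integral>\<omega>. indicator B (V \<omega>) \<partial>M)"
        "measure (distr M borel U) A = (\<integral>\<omega>. indicator A (U \<omega>) \<partial>M)"
        using integral_distr[of V M borel "indicator B :: real \<Rightarrow> real"]
          integral_distr[of U M borel "indicator A :: real \<Rightarrow> real"] by auto
      interpret DJ: prob_space "distr M (borel \<Otimes>\<^sub>M borel) (\<lambda>x. (U x, V x))"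
        by (rule prob_space_distr) simp
      have "measure (distr M (borel \<Otimes>\<^sub>M borel) (\<lambda>x. (U x, V x))) (A \<times> B)
         = (\<integral>z. indicator (A \<times> B) z \<partial>distr M (borel \<Otimes>\<^sub>M borel) (\<lambda>x. (U x, V x)))"
        by simp
      also have "\<dots> = (\<integral>\<omega>. indicator (A \<times> B) (U \<omega>, V \<omega>) \<partial>M)"
        by (rule integral_distr) auto
      also have "\<dots> = (\<integral>\<omega>. indicator B (V \<omega>) * indicator A (U \<omega>) \<partial>M)"
        by (intro Bochner_Integration.integral_cong) (auto split: split_indicator)
      also have "\<dots> = measure (distr M borel U) A * measure (distr M borel V) B"
        by (simp add: main r)
      finally show "emeasure (distr M borel U) A * emeasure (distr M borel V) B
        = emeasure (distr M (borel \<Otimes>\<^sub>M borel) (\<lambda>x. (U x, V x))) (A \<times> B)"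
        by (simp add: DU.emeasure_eq_measure DV.emeasure_eq_measure DJ.emeasure_eq_measure ennreal_mult)
    qed (auto intro: DU.sigma_finite_measure_axioms DV.sigma_finite_measure_axioms)
  qed
qed

subsection \<open>Symmetrization\<close>

lemma target_char_diff:
  "target_char t s * target_char (-t) (-s)
     = complex_of_real (exp (- 4 * \<bar>t\<bar> - 2 * t\<^sup>2) / (1 + s\<^sup>2)\<^sup>2)"
proof -
  have "target_char t s * target_char (-t) (-s)
      = exp ((complex_of_real (- 2 * \<bar>t\<bar> - t\<^sup>2) + \<i> * complex_of_real (t\<^sup>2 * s))
          + (complex_of_real (- 2 * \<bar>-t\<bar> - (-t)\<^sup>2) + \<i> * complex_of_real ((-t)\<^sup>2 * (-s))))
        / (complex_of_real (1 + s\<^sup>2) * complex_of_real (1 + (-s)\<^sup>2))"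
    by (simp only: target_char_def exp_add times_divide_times_eq)
  also have "(complex_of_real (- 2 * \<bar>t\<bar> - t\<^sup>2) + \<i> * complex_of_real (t\<^sup>2 * s))
          + (complex_of_real (- 2 * \<bar>-t\<bar> - (-t)\<^sup>2) + \<i> * complex_of_real ((-t)\<^sup>2 * (-s)))
      = of_real (- 4 * \<bar>t\<bar> - 2 * t\<^sup>2)"
    by simp
  also have "exp (complex_of_real (- 4 * \<bar>t\<bar> - 2 * t\<^sup>2)) / (complex_of_real (1 + s\<^sup>2) * complex_of_real (1 + (-s)\<^sup>2))
     = complex_of_real (exp (- 4 * \<bar>t\<bar> - 2 * t\<^sup>2) / (1 + s\<^sup>2)\<^sup>2)"
    unfolding exp_of_real by (simp add: power2_eq_square)
  finally show ?thesis .
qed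

lemma (in prob_space) joint_char_symmetrized:
  assumes X [measurable]: "X \<in> borel_measurable M" and Y [measurable]: "Y \<in> borel_measurable M"
    and copy: "independent_copy X Y X' Y'"
  shows "joint_char (\<lambda>\<omega>. X \<omega> - X' \<omega>) (\<lambda>\<omega>. Y \<omega> - Y' \<omega>) t s = joint_char X Y t s * joint_char X Y (-t) (-s)"
proof -
  have X' [measurable]: "X' \<in> borel_measurable M" and Y' [measurable]: "Y' \<in> borel_measurable M"
    and ind: "indep_var borel (\<lambda>\<omega>. (X \<omega>, Y \<omega>)) borel (\<lambda>\<omega>. (X' \<omega>, Y' \<omega>))"
    and d: "distr M borel (\<lambda>\<omega>. (X' \<omega>, Y' \<omega>)) = distr M borel (\<lambda>\<omega>. (X \<omega>, Y \<omega>))"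
    using copy by (auto simp: independent_copy_def)
  define e where "e t s z = iexp (t * fst z + s * snd z)" for t s :: real and z
  have e [measurable]: "e t s \<in> borel_measurable borel" for t s
    unfolding e_def borel_prod[symmetric] by measurable
  have jc: "joint_char X Y t s = (CLINT \<omega>|M. e t s (X \<omega>, Y \<omega>))" for t s
    by (simp add: joint_char_def e_def)
  have pair: "(\<lambda>\<omega>. (U \<omega>, V \<omega>)) \<in> measurable M borel"
    if "U \<in> borel_measurable M" "V \<in> borel_measurable M" for U V :: "'a \<Rightarrow> real"
    using that unfolding borel_prod[symmetric] by measurable
  \<comment> \<open>Equality of the joint laws on the plane lets the copy replace the original pair
    inside the expectation.\<close>
  have "joint_char X Y (-t) (-s) = (CLINT z|distr M borel (\<lambda>\<omega>. (X \<omega>, Y \<omega>)). e (-t) (-s) z)"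
    unfolding jc by (rule integral_distr[symmetric]) (auto intro: pair)
  also have "\<dots> = (CLINT \<omega>|M. e (-t) (-s) (X' \<omega>, Y' \<omega>))"
    unfolding d[symmetric] by (rule integral_distr) (auto intro: pair)
  finally have jc': "joint_char X Y (-t) (-s) = \<dots>" .
  have "joint_char (\<lambda>\<omega>. X \<omega> - X' \<omega>) (\<lambda>\<omega>. Y \<omega> - Y' \<omega>) t s
      = (CLINT \<omega>|M. e t s (X \<omega>, Y \<omega>) * e (-t) (-s) (X' \<omega>, Y' \<omega>))"
    by (simp add: joint_char_def e_def exp_add[symmetric] algebra_simps)
  also have "\<dots> = (CLINT \<omega>|M. e t s (X \<omega>, Y \<omega>)) * (CLINT \<omega>|M. e (-t) (-s) (X' \<omega>, Y' \<omega>))"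
  proof (rule indep_var_lebesgue_integral)
    show "indep_var borel (\<lambda>\<omega>. e t s (X \<omega>, Y \<omega>)) borel (\<lambda>\<omega>. e (-t) (-s) (X' \<omega>, Y' \<omega>))"
      using indep_var_compose[OF ind e e] by (simp add: comp_def)
    show "integrable M (\<lambda>\<omega>. e t s (X \<omega>, Y \<omega>))" "integrable M (\<lambda>\<omega>. e (-t) (-s) (X' \<omega>, Y' \<omega>))"
      unfolding e_def by (auto intro!: integrable_const_bound[of _ 1] simp del: of_real_add of_real_mult)
  qed
  finally show ?thesis unfolding jc' by (simp only: jc)
qed

lemma (in prob_space) indep_symmetrized:
  assumes X: "X \<in> borel_measurable M" and Y: "Y \<in> borel_measurable M"
    and jc: "\<And>t s. joint_char X Y t s = target_char t s"
    and copy: "independent_copy X Y X' Y'"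
  shows "indep_var borel (\<lambda>\<omega>. X \<omega> - X' \<omega>) borel (\<lambda>\<omega>. Y \<omega> - Y' \<omega>)"
proof (rule indep_var_of_joint_char)
  have "X' \<in> borel_measurable M" "Y' \<in> borel_measurable M"
    using copy by (auto simp: independent_copy_def)
  then show "(\<lambda>\<omega>. X \<omega> - X' \<omega>) \<in> borel_measurable M" "(\<lambda>\<omega>. Y \<omega> - Y' \<omega>) \<in> borel_measurable M"
    using X Y by simp_all
  have *: "joint_char (\<lambda>\<omega>. X \<omega> - X' \<omega>) (\<lambda>\<omega>. Y \<omega> - Y' \<omega>) t s
      = complex_of_real (exp (- 4 * \<bar>t\<bar> - 2 * t\<^sup>2) / (1 + s\<^sup>2)\<^sup>2)" for t s
    unfolding joint_char_symmetrized[OF X Y copy] jc by (rule target_char_diff)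
  show "joint_char (\<lambda>\<omega>. X \<omega> - X' \<omega>) (\<lambda>\<omega>. Y \<omega> - Y' \<omega>) t s
     = joint_char (\<lambda>\<omega>. X \<omega> - X' \<omega>) (\<lambda>\<omega>. Y \<omega> - Y' \<omega>) t 0 * joint_char (\<lambda>\<omega>. X \<omega> - X' \<omega>) (\<lambda>\<omega>. Y \<omega> - Y' \<omega>) 0 s" for t s
    unfolding * of_real_mult[symmetric] by simp
qed

section \<open>Dependence of the original pair, and its realization together with a copy\<close>

lemma (in prob_space) joint_char_indep:
  assumes ind: "indep_var borel X borel Y"
  shows "joint_char X Y t s = joint_char X Y t 0 * joint_char X Y 0 s"
proof -
  have [measurable]: "X \<in> borel_measurable M" "Y \<in> borel_measurable M"
    using indep_var_rv1[OF ind] indep_var_rv2[OF ind] by auto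
  have "joint_char X Y t s = (CLINT \<omega>|M. iexp (t * X \<omega>) * iexp (s * Y \<omega>))"
    by (simp add: joint_char_def exp_add[symmetric] distrib_left)
  also have "\<dots> = (CLINT \<omega>|M. iexp (t * X \<omega>)) * (CLINT \<omega>|M. iexp (s * Y \<omega>))"
    by (intro indep_var_lebesgue_integral indep_var_compose[unfolded comp_def, OF ind])
       (auto intro!: integrable_const_bound[of _ 1])
  finally show ?thesis by (simp add: joint_char_def)
qed

text \<open>The point (1, pi) makes the phase exp (i pi) = -1, while the phase is trivial on both
  axes. Factorization would therefore equate a negative real number with its positive
  counterpart.\<close>

lemma (in prob_space) not_indep_of_target_char:
  assumes jc: "\<And>t s. joint_char X Y t s = target_char t s"
  shows "\<not> indep_var borel X borel Y"
proof
  assume "indep_var borel X borel Y"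
  then have "target_char 1 pi = target_char 1 0 * target_char 0 pi"
    using joint_char_indep[of X Y 1 pi] by (simp add: jc)
  moreover have "target_char 1 pi = - of_real (exp (-3) / (1 + pi\<^sup>2))"
    by (simp add: target_char_def exp_of_real[symmetric] exp_diff exp_minus divide_inverse)
  moreover have "target_char 1 0 * target_char 0 pi = of_real (exp (-3) / (1 + pi\<^sup>2))"
    by (simp add: target_char_def exp_of_real[symmetric])
  ultimately have "complex_of_real (- (exp (-3) / (1 + pi\<^sup>2))) = of_real (exp (-3) / (1 + pi\<^sup>2))"
    by (simp only: of_real_minus)
  then have "- (exp (-3) / (1 + pi\<^sup>2)) = exp (-3 :: real) / (1 + pi\<^sup>2)"
    by (simp only: of_real_eq_iff)
  moreover have "exp (-3 :: real) / (1 + pi\<^sup>2) > 0"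
    by (intro divide_pos_pos) (auto intro: add_pos_nonneg)
  ultimately show False by linarith
qed

text \<open>The canonical model: on the product of \<mu> with itself, the first projection is the
  pair and the second one its independent copy.\<close>

lemma independent_copy_pair:
  fixes \<mu> :: "(real \<times> real) measure"
  assumes \<mu>: "prob_space \<mu>" and sets: "sets \<mu> = sets borel"
  defines "X \<equiv> \<lambda>\<omega> :: (real \<times> real) \<times> (real \<times> real). fst (fst \<omega>)"
    and "Y \<equiv> \<lambda>\<omega> :: (real \<times> real) \<times> (real \<times> real). snd (fst \<omega>)"
    and "X' \<equiv> \<lambda>\<omega> :: (real \<times> real) \<times> (real \<times> real). fst (snd \<omega>)"
    and "Y' \<equiv> \<lambda>\<omega> :: (real \<times> real) \<times> (real \<times> real). snd (snd \<omega>)"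
  shows "prob_space (\<mu> \<Otimes>\<^sub>M \<mu>)" "X \<in> borel_measurable (\<mu> \<Otimes>\<^sub>M \<mu>)" "Y \<in> borel_measurable (\<mu> \<Otimes>\<^sub>M \<mu>)"
    "prob_space.joint_char (\<mu> \<Otimes>\<^sub>M \<mu>) X Y = char2 \<mu>"
    "prob_space.independent_copy (\<mu> \<Otimes>\<^sub>M \<mu>) X Y X' Y'"
proof -
  interpret M1: prob_space \<mu> by (rule \<mu>)
  interpret P: pair_prob_space \<mu> \<mu> ..
  show ps: "prob_space (\<mu> \<Otimes>\<^sub>M \<mu>)" by (rule P.prob_space_axioms)
  note sets [measurable_cong]
  have f1 [measurable]: "fst \<in> borel_measurable \<mu>" and f2 [measurable]: "snd \<in> borel_measurable \<mu>"
    unfolding measurable_cong_sets[OF sets refl] borel_prod[symmetric] by measurable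
  show mX: "X \<in> borel_measurable (\<mu> \<Otimes>\<^sub>M \<mu>)" and mY: "Y \<in> borel_measurable (\<mu> \<Otimes>\<^sub>M \<mu>)"
    unfolding X_def Y_def by measurable
  have mX': "X' \<in> borel_measurable (\<mu> \<Otimes>\<^sub>M \<mu>)" and mY': "Y' \<in> borel_measurable (\<mu> \<Otimes>\<^sub>M \<mu>)"
    unfolding X'_def Y'_def by measurable
  have m: "fst \<in> measurable (\<mu> \<Otimes>\<^sub>M \<mu>) borel" "snd \<in> measurable (\<mu> \<Otimes>\<^sub>M \<mu>) borel" by measurable
  have e_m: "(\<lambda>z. iexp (t * fst z + s * snd z)) \<in> borel_measurable (borel :: (real \<times> real) measure)" for t s
    unfolding borel_prod[symmetric] by measurable
  have d1: "distr (\<mu> \<Otimes>\<^sub>M \<mu>) borel fst = \<mu>"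
  proof -
    have "distr (\<mu> \<Otimes>\<^sub>M \<mu>) borel fst = distr (\<mu> \<Otimes>\<^sub>M \<mu>) \<mu> fst"
      by (rule distr_cong) (simp_all add: sets)
    then show ?thesis by (simp add: M1.distr_pair_fst)
  qed
  have d2: "distr (\<mu> \<Otimes>\<^sub>M \<mu>) borel snd = \<mu>"
  proof (rule measure_eqI)
    fix A assume "A \<in> sets (distr (\<mu> \<Otimes>\<^sub>M \<mu>) borel snd)"
    then have A: "A \<in> sets \<mu>" by (simp add: sets)
    have "emeasure (distr (\<mu> \<Otimes>\<^sub>M \<mu>) borel snd) A = emeasure (\<mu> \<Otimes>\<^sub>M \<mu>) (snd -` A \<inter> space (\<mu> \<Otimes>\<^sub>M \<mu>))"
      using A by (subst emeasure_distr) (auto simp: sets)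
    also have "snd -` A \<inter> space (\<mu> \<Otimes>\<^sub>M \<mu>) = space \<mu> \<times> A"
      using sets.sets_into_space[OF A] by (auto simp: space_pair_measure)
    also have "emeasure (\<mu> \<Otimes>\<^sub>M \<mu>) (space \<mu> \<times> A) = emeasure \<mu> A"
      using A by (subst M1.emeasure_pair_measure_Times) (auto simp: M1.emeasure_space_1)
    finally show "emeasure (distr (\<mu> \<Otimes>\<^sub>M \<mu>) borel snd) A = emeasure \<mu> A" .
  qed (simp add: sets)
  show "prob_space.joint_char (\<mu> \<Otimes>\<^sub>M \<mu>) X Y = char2 \<mu>"
  proof (intro ext)
    fix t s
    have "char2 \<mu> t s = (CLINT z|distr (\<mu> \<Otimes>\<^sub>M \<mu>) borel fst. iexp (t * fst z + s * snd z))"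
      unfolding d1 char2_def ..
    also have "\<dots> = (CLINT \<omega>|\<mu> \<Otimes>\<^sub>M \<mu>. iexp (t * X \<omega> + s * Y \<omega>))"
      unfolding X_def Y_def by (rule integral_distr[OF m(1) e_m])
    finally show "prob_space.joint_char (\<mu> \<Otimes>\<^sub>M \<mu>) X Y t s = char2 \<mu> t s"
      unfolding prob_space.joint_char_def[OF ps] by simp
  qed
  have e: "(\<lambda>\<omega>. (X \<omega>, Y \<omega>)) = fst" "(\<lambda>\<omega>. (X' \<omega>, Y' \<omega>)) = snd"
    by (auto simp: X_def Y_def X'_def Y'_def)
  \<comment> \<open>Pairing the two projections gives the identity map, so their joint law is the
    product measure itself, which is the product of the marginals \<open>d1\<close> and
    \<open>d2\<close>.\<close>
  have "distr (\<mu> \<Otimes>\<^sub>M \<mu>) (borel \<Otimes>\<^sub>M borel) (\<lambda>x. (fst x, snd x)) = distr (\<mu> \<Otimes>\<^sub>M \<mu>) (\<mu> \<Otimes>\<^sub>M \<mu>) (\<lambda>x. x)"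
    by (rule distr_cong) (auto intro!: sets_pair_measure_cong simp: sets)
  then have "prob_space.indep_var (\<mu> \<Otimes>\<^sub>M \<mu>) borel fst borel snd"
    unfolding prob_space.indep_var_distribution_eq[OF ps] using m d1 d2 by simp
  then show "prob_space.independent_copy (\<mu> \<Otimes>\<^sub>M \<mu>) X Y X' Y'"
    unfolding prob_space.independent_copy_def[OF ps] e using mX' mY' d1 d2 by simp
qed

theorem mainTheorem2:
  shows "(\<exists>(M :: (real \<times> real) measure) (X :: real \<times> real \<Rightarrow> real) (Y :: real \<times> real \<Rightarrow> real).
            prob_space M \<and> X \<in> borel_measurable M \<and> Y \<in> borel_measurable M \<and>
            (\<forall>t s. prob_space.joint_char M X Y t s = target_char t s)) \<and>
    (\<exists>\<mu> :: (real \<times> real) measure.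
            prob_space \<mu> \<and> sets \<mu> = sets borel \<and> (\<forall>t s. char2 \<mu> t s = target_char t s)) \<and>
    (\<forall>(M :: 'a measure) (X :: 'a \<Rightarrow> real) (Y :: 'a \<Rightarrow> real) (X' :: 'a \<Rightarrow> real) (Y' :: 'a \<Rightarrow> real).
            prob_space M \<longrightarrow> X \<in> borel_measurable M \<longrightarrow> Y \<in> borel_measurable M \<longrightarrow>
            (\<forall>t s. prob_space.joint_char M X Y t s = target_char t s) \<longrightarrow>
            prob_space.independent_copy M X Y X' Y' \<longrightarrow>
              prob_space.indep_var M borel (\<lambda>\<omega>. X \<omega> - X' \<omega>) borel (\<lambda>\<omega>. Y \<omega> - Y' \<omega>) \<and>
              \<not> prob_space.indep_var M borel X borel Y) \<and>
    (\<not> (\<forall>(M :: ((real \<times> real) \<times> (real \<times> real)) measure) X Y X' Y'.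
            prob_space M \<longrightarrow> X \<in> borel_measurable M \<longrightarrow> Y \<in> borel_measurable M \<longrightarrow>
            prob_space.independent_copy M X Y X' Y' \<longrightarrow>
            prob_space.indep_var M borel (\<lambda>\<omega>. X \<omega> - X' \<omega>) borel (\<lambda>\<omega>. Y \<omega> - Y' \<omega>) \<longrightarrow>
            prob_space.indep_var M borel X borel Y))"
proof -
  obtain \<mu> :: "(real \<times> real) measure" where \<mu>: "prob_space \<mu>" "sets \<mu> = sets borel"
    and ch: "\<And>t s. char2 \<mu> t s = target_char t s"
    using target_char_is_char2 by blast
  have f: "fst \<in> borel_measurable \<mu>" "snd \<in> borel_measurable \<mu>"
    unfolding measurable_cong_sets[OF \<mu>(2) refl] borel_prod[symmetric] by measurable
  have "\<forall>t s. prob_space.joint_char \<mu> fst snd t s = target_char t s"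
    using ch by (simp add: prob_space.joint_char_def[OF \<mu>(1)] char2_def)
  note part1 = \<mu>(1) f this
  \<comment> \<open>A single plane is enough to carry the pair, but the refutation of the
    implication also needs a copy to exist; therefore it takes place on \<mu> times \<mu>.\<close>
  note C = independent_copy_pair[OF \<mu>]
  have jc: "prob_space.joint_char (\<mu> \<Otimes>\<^sub>M \<mu>) (\<lambda>\<omega>. fst (fst \<omega>)) (\<lambda>\<omega>. snd (fst \<omega>)) t s = target_char t s" for t s
    unfolding C(4) by (rule ch)
  note part4 = C(1-3,5) prob_space.indep_symmetrized[OF C(1-3) jc C(5)]
    prob_space.not_indep_of_target_char[OF C(1) jc]
  show ?thesis
  proof (intro conjI target_char_is_char2 notI allI impI)
    show "\<exists>(M :: (real \<times> real) measure) (X :: real \<times> real \<Rightarrow> real) (Y :: real \<times> real \<Rightarrow> real).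
            prob_space M \<and> X \<in> borel_measurable M \<and> Y \<in> borel_measurable M \<and>
            (\<forall>t s. prob_space.joint_char M X Y t s = target_char t s)"
      by (intro exI conjI) (fact part1)+
  next
    fix M :: "'a measure" and X Y X' Y' :: "'a \<Rightarrow> real"
    assume M: "prob_space M" "X \<in> borel_measurable M" "Y \<in> borel_measurable M"
      and jc: "\<forall>t s. prob_space.joint_char M X Y t s = target_char t s"
      and c: "prob_space.independent_copy M X Y X' Y'"
    show "prob_space.indep_var M borel (\<lambda>\<omega>. X \<omega> - X' \<omega>) borel (\<lambda>\<omega>. Y \<omega> - Y' \<omega>)"
      by (rule prob_space.indep_symmetrized[OF M jc[rule_format] c])
    assume "prob_space.indep_var M borel X borel Y"
    then show False
      using prob_space.not_indep_of_target_char[OF M(1) jc[rule_format]] by contradiction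
  next
    assume "\<forall>(M :: ((real \<times> real) \<times> (real \<times> real)) measure) X Y X' Y'.
            prob_space M \<longrightarrow> X \<in> borel_measurable M \<longrightarrow> Y \<in> borel_measurable M \<longrightarrow>
            prob_space.independent_copy M X Y X' Y' \<longrightarrow>
            prob_space.indep_var M borel (\<lambda>\<omega>. X \<omega> - X' \<omega>) borel (\<lambda>\<omega>. Y \<omega> - Y' \<omega>) \<longrightarrow>
            prob_space.indep_var M borel X borel Y"
    from this[rule_format, OF part4(1-5)] part4(6) show False by contradiction
  qed
qed

end
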